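(* Let $L/\mathbb{Q}$ be a cyclic quartic extension, $L=\mathbb{Q}\big(\sqrt{a(d+b_0\sqrt d)}\big)$ with parameters $a,b_0,c_0,d$ as in the context, and let $H$ be its unique non-classical Hopf-Galois structure. Put $(b,c)=(b_0,c_0)$ if $b_0$ is odd and $(b,c)=(c_0,b_0)$ if $b_0$ is even (so $b$ is odd and $d=b^2+c^2$). The following are equivalent: 1. $\mathcal{O}_L$ is $\mathfrak{A}_H$-free. 2. The quadratic form $[b,2c,-b]$ represents $1$, i.e. there are $U,V\in\mathbb{Z}$ with $bU^2+2cUV-bV^2=1$. 3. The equation $x^2-dy^2=b$ is solvable in $\mathbb{Z}$ and has some solution $(x,y)$ such that $b$ divides $x-cy$. Moreover, in that case, with $(x,y)$ a solution as in 3, $x'=\frac{x-cy}{b}$ and $y'=\frac{y-x'+1}{2}$, $\mathcal{O}_L$ has an $\mathfrak{A}_H$-generator $\beta=\beta_1\gamma_1+\beta_2\gamma_2+\beta_3\gamma_3+\beta_4\gamma_4$, where $\{\gamma_1,\gamma_2,\gamma_3,\gamma_4\}$ is the integral basis given in the context and the values of $\beta_i\in\mathbb{Z}$ are: - Case 1: $(\beta_1,\beta_2,\beta_3,\beta_4)=(1,1,x',y)$. - Cases 2 and 3: $(\beta_1,\beta_2,\beta_3,\beta_4)=(0,1,x',y)$. - Case 4: $(\beta_1,\beta_2,\beta_3,\beta_4)=\big(-\lceil y/2\rceil,\ y',\ x',\ y\big)$. - Case 5: $(\beta_1,\beta_2,\beta_3,\beta_4)=\big(-\lceil y/2\rceil,\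 y',\ y,\ x'\big)$.
   Context: Every cyclic quartic extension of $\mathbb{Q}$ is of the form $L=\mathbb{Q}\big(\sqrt{a(d+b_0\sqrt d)}\big)$, where $a\in\mathbb{Z}$ is odd and square-free, $b_0\in\mathbb{Z}_{>0}$, $d=b_0^2+c_0^2$ is square-free for some $c_0\in\mathbb{Z}_{>0}$, and $\gcd(a,d)=1$. Let $z=\sqrt{a(d+b_0\sqrt d)}$ and $w=\sqrt{a(d-b_0\sqrt d)}$ (principal square roots, so that $zw=ac_0\sqrt d$). An integral basis $\{\gamma_1,\gamma_2,\gamma_3,\gamma_4\}$ of $L$ (in this order) is: Case 1, $d$ even: $\{1,\sqrt d,z,w\}$. Case 2, $d$ odd and $b_0$ odd: $\{1,\frac{1+\sqrt d}{2},z,w\}$. Case 3, $d$ odd, $b_0$ even, $a+b_0\equiv3\pmod 4$: $\{1,\frac{1+\sqrt d}{2},\frac{z+w}{2},\frac{z-w}{2}\}$. Case 4, $d$ odd, $b_0$ even, $a+b_0\equiv1\pmod 4$, $a\equiv c_0\pmod 4$: $\{1,\frac{1+\sqrt d}{2},\frac{1+\sqrt d+z+w}{4},\frac{1-\sqrt d+z-w}{4}\}$. Case 5, $d$ odd, $b_0$ even, $a+b_0\equiv1\pmod 4$, $a\equiv-c_0\pmod 4$: $\{1,\frac{1+\sqrt d}{2},\frac{1+\sqrt d+z-w}{4},\frac{1-\sqrt d+z+w}{4}\}$. $L/\mathbb{Q}$ has a unique non-classical Hopf-Galois structure $H$ (a Hopf-Galois structure is a finite-dimensional cocommutative $\mathbb{Q}$-Hopf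 algebra $H$ with an action making $L$ a left $H$-module algebra such that $L\otimes_{\mathbb{Q}} H\to\mathrm{End}_{\mathbb{Q}}(L)$, $x\otimes h\mapsto (y\mapsto x(h\cdot y))$ is bijective; the classical one is the group algebra $\mathbb{Q}[\mathrm{Gal}(L/\mathbb{Q})]$ with the Galois action). Explicitly, let $\sigma$ be the generator of $\mathrm{Gal}(L/\mathbb{Q})$ with $z\mapsto w\mapsto -z\mapsto -w$. Since the action is faithful, $H$ is identified, as an algebra acting on $L$, with the subalgebra of $\mathrm{End}_{\mathbb{Q}}(L)$ having $\mathbb{Q}$-basis $\mathrm{id},\ \sigma^2,\ \sigma+\sigma^3,\ \sqrt d\,(\sigma-\sigma^3)$. $\mathcal{O}_L$ is the ring of integers of $L$, and the associated order is $\mathfrak{A}_H=\{h\in H: h\cdot\mathcal{O}_L\subseteq\mathcal{O}_L\}$. "$\mathcal{O}_L$ is $\mathfrak{A}_H$-free" means free (of rank one) as $\mathfrak{A}_H$-module; an $\mathfrak{A}_H$-generator is a $\beta\in\mathcal{O}_L$ such that $\mathfrak{A}_H\to\mathcal{O}_L$, $h\mapsto h\cdot\beta$, is bijective.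
   Formalization: In Case 5 the printed coordinates fail (e.g. a=-1, b_0=2, c_0=1, d=5, (x,y)=(9,4)); the formal statement uses (-⌈x'/2⌉, 1-y', y, x') in place of (-⌈y/2⌉, y', y, x'). *)

theory Defs
  imports
    Complex_Main
    "HOL-Library.FuncSet"
    "HOL-Computational_Algebra.Computational_Algebra"
    "HOL-Number_Theory.Cong"
begin

definition is_subfield :: "complex set \<Rightarrow> bool" where
  "is_subfield K \<longleftrightarrow> 1 \<in> K \<and> (\<forall>x\<in>K. \<forall>y\<in>K. x - y \<in> K \<and> x * y \<in> K) \<and> (\<forall>x\<in>K. inverse x \<in> K)"

abbreviation adjoin :: "complex \<Rightarrow> complex set" where
  "adjoin x \<equiv> is_subfield hull {x}"

definition ring_of_integers :: "complex set \<Rightarrow> complex set" where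
  "ring_of_integers L = {x \<in> L. algebraic_int x}"

text \<open>Automorphisms are functions on all of \<open>complex\<close>; their values outside \<open>L\<close> are irrelevant.\<close>

definition galois_group :: "complex set \<Rightarrow> (complex \<Rightarrow> complex) set" where
  "galois_group L = {\<sigma>. bij_betw \<sigma> L L \<and>
     (\<forall>x\<in>L. \<forall>y\<in>L. \<sigma> (x + y) = \<sigma> x + \<sigma> y \<and> \<sigma> (x * y) = \<sigma> x * \<sigma> y) \<and>
     (\<forall>q. \<sigma> (of_rat q) = of_rat q)}"

definition sqrt_d :: "int \<Rightarrow> complex" where
  "sqrt_d d = of_real (sqrt (of_int d))"

definition gen_z :: "int \<Rightarrow> int \<Rightarrow> int \<Rightarrow> complex" where
  "gen_z a b0 d = csqrt (of_int a * (of_int d + of_int b0 * sqrt_d d))"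

definition gen_w :: "int \<Rightarrow> int \<Rightarrow> int \<Rightarrow> complex" where
  "gen_w a b0 d = csqrt (of_int a * (of_int d - of_int b0 * sqrt_d d))"

text \<open>
  The unique non-classical Hopf-Galois structure on the cyclic quartic field \<open>L\<close>, as an algebra of
  \<open>\<rat>\<close>-linear endomorphisms of \<open>L\<close>: the \<open>\<rat>\<close>-span of \<open>id\<close>, \<open>\<sigma>\<^sup>2\<close>, \<open>\<sigma> + \<sigma>\<^sup>3\<close> and
  \<open>\<surd>d (\<sigma> - \<sigma>\<^sup>3)\<close>. Endomorphisms are restricted to \<open>L\<close>, so that two of them are equal as HOL
  functions iff they agree on \<open>L\<close>.
\<close>

definition nonclassical_hopf :: "complex set \<Rightarrow> (complex \<Rightarrow> complex) \<Rightarrow> int \<Rightarrow> (complex \<Rightarrow> complex) set"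
  where
  "nonclassical_hopf L \<sigma> d =
     {(\<lambda>x\<in>L. of_rat p * x + of_rat q * (\<sigma> ^^ 2) x + of_rat r * (\<sigma> x + (\<sigma> ^^ 3) x)
             + of_rat t * (sqrt_d d * (\<sigma> x - (\<sigma> ^^ 3) x))) | p q r t. True}"

definition associated_order :: "(complex \<Rightarrow> complex) set \<Rightarrow> complex set \<Rightarrow> (complex \<Rightarrow> complex) set"
  where
  "associated_order H R = {h \<in> H. h ` R \<subseteq> R}"

definition is_free_generator :: "(complex \<Rightarrow> complex) set \<Rightarrow> complex set \<Rightarrow> complex \<Rightarrow> bool" where
  "is_free_generator A R \<beta> \<longleftrightarrow> \<beta> \<in> R \<and> bij_betw (\<lambda>h. h \<beta>) A R"

definition free_of_rank_one :: "(complex \<Rightarrow> complex) set \<Rightarrow> complex set \<Rightarrow> bool" where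
  "free_of_rank_one A R \<longleftrightarrow> (\<exists>\<beta>. is_free_generator A R \<beta>)"

text \<open>The integral binary quadratic form \<open>[A, B, C]\<close> is \<open>A U\<^sup>2 + B U V + C V\<^sup>2\<close>.\<close>

definition form_represents :: "int \<Rightarrow> int \<Rightarrow> int \<Rightarrow> int \<Rightarrow> bool" where
  "form_represents A B C n \<longleftrightarrow> (\<exists>U V :: int. A * U^2 + B * U * V + C * V^2 = n)"

text \<open>
  The five cases for the parameters. If \<open>d = b0\<^sup>2 + c0\<^sup>2\<close> with \<open>a\<close> odd, exactly one of them holds:
  when \<open>d\<close> is odd and \<open>b0\<close> even, both \<open>a + b0\<close> and \<open>c0\<close> are odd.
\<close>

definition case1 :: "int \<Rightarrow> bool" where
  "case1 d \<longleftrightarrow> even d"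

definition case2 :: "int \<Rightarrow> int \<Rightarrow> bool" where
  "case2 b0 d \<longleftrightarrow> odd d \<and> odd b0"

definition case3 :: "int \<Rightarrow> int \<Rightarrow> int \<Rightarrow> bool" where
  "case3 a b0 d \<longleftrightarrow> odd d \<and> even b0 \<and> [a + b0 = 3] (mod 4)"

definition case4 :: "int \<Rightarrow> int \<Rightarrow> int \<Rightarrow> int \<Rightarrow> bool" where
  "case4 a b0 c0 d \<longleftrightarrow> odd d \<and> even b0 \<and> [a + b0 = 1] (mod 4) \<and> [a = c0] (mod 4)"

definition case5 :: "int \<Rightarrow> int \<Rightarrow> int \<Rightarrow> int \<Rightarrow> bool" where
  "case5 a b0 c0 d \<longleftrightarrow> odd d \<and> even b0 \<and> [a + b0 = 1] (mod 4) \<and> [a = - c0] (mod 4)"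

definition integral_basis :: "int \<Rightarrow> int \<Rightarrow> int \<Rightarrow> int \<Rightarrow> complex list" where
  "integral_basis a b0 c0 d =
     (let s = sqrt_d d; z = gen_z a b0 d; w = gen_w a b0 d in
      if case1 d then [1, s, z, w]
      else if case2 b0 d then [1, (1 + s) / 2, z, w]
      else if case3 a b0 d then [1, (1 + s) / 2, (z + w) / 2, (z - w) / 2]
      else if case4 a b0 c0 d then [1, (1 + s) / 2, (1 + s + z + w) / 4, (1 - s + z - w) / 4]
      else if case5 a b0 c0 d then [1, (1 + s) / 2, (1 + s + z - w) / 4, (1 - s + z + w) / 4]
      else undefined)"

text \<open>
  Coordinates, with respect to the integral basis, of the generator attached to a solution \<open>(x, y)\<close>
  of \<open>x\<^sup>2 - d y\<^sup>2 = b\<close> with \<open>b\<close> dividing \<open>x - c y\<close>, where \<open>x' = (x - c y) / b\<close> and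
  \<open>y' = (y - x' + 1) / 2\<close>. They are rational expressions (divisions are exact) whose integrality is
  to be proved.

  Case 5 is the image of case 4 under \<open>(c0, w) \<mapsto> (-c0, -w)\<close>. As \<open>b = c0\<close> there, this replaces \<open>b\<close> by
  \<open>-b\<close> and hence exchanges \<open>x'\<close> and \<open>y\<close> in the whole vector, including in its first two entries:
  these are \<open>- \<lceil>x' / 2\<rceil>\<close> and \<open>(x' - y + 1) / 2 = 1 - y'\<close>. With \<open>- \<lceil>y / 2\<rceil>\<close> and \<open>y'\<close> instead, one
  gets no generator unless \<open>y' = 0\<close>; for instance none at all for \<open>a = -1\<close>, \<open>b0 = 2\<close>, \<open>c0 = 5\<close>.
\<close>

definition generator_coords ::
  "int \<Rightarrow> int \<Rightarrow> int \<Rightarrow> int \<Rightarrow> int \<Rightarrow> int \<Rightarrow> int \<Rightarrow> int \<Rightarrow> rat list" where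
  "generator_coords a b0 c0 d b c x y =
     (let x' = of_int (x - c * y) / of_int b; y' = (of_int y - x' + 1) / 2 in
      if case1 d then [1, 1, x', of_int y]
      else if case2 b0 d \<or> case3 a b0 d then [0, 1, x', of_int y]
      else if case4 a b0 c0 d then [- of_int \<lceil>of_int y / 2 :: rat\<rceil>, y', x', of_int y]
      else if case5 a b0 c0 d then [- of_int \<lceil>x' / 2\<rceil>, 1 - y', of_int y, x']
      else undefined)"

definition combination :: "rat list \<Rightarrow> complex list \<Rightarrow> complex" where
  "combination q v = (\<Sum>i<4. of_rat (q ! i) * v ! i)"

end

theory Submission
  imports Defs "Jordan_Normal_Form.Char_Poly"
begin

text \<open>
  On \<open>L = \<rat> \<oplus> \<rat> \<surd>d \<oplus> (\<rat> z \<oplus> \<rat> w)\<close> the algebra \<open>H\<close> acts by independent scalars on the first two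
  summands and by \<open>\<rat>[M] \<cong> \<rat>(\<surd>d)\<close> on the third one, where \<open>M z = c\<^sub>0 z - b\<^sub>0 w\<close> and
  \<open>M w = - b\<^sub>0 z - c\<^sub>0 w\<close>. The projection of \<open>\<O>\<^sub>L\<close> to the third summand has a \<open>\<int>\<close>-basis in which \<open>M\<close>
  becomes \<open>(m, n; n, -m)\<close> with \<open>{\<bar>m\<bar>, \<bar>n\<bar>} = {b\<^sub>0, c\<^sub>0}\<close> and \<open>n\<close> odd, so elements of the associated
  order act on it through \<open>\<int>[M]\<close>. A generator with projection \<open>(u, v)\<close> therefore makes
  \<open>(u, v)\<close>, \<open>M (u, v)\<close> a basis of \<open>\<int>\<^sup>2\<close>, and the determinant of this pair is
  \<open>n u\<^sup>2 - 2 m u v - n v\<^sup>2\<close>, which is the form \<open>[b, 2 c, - b]\<close> up to obvious changes of variables.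
  Conversely, a solution determines a generator once the first two coordinates are as small as
  \<open>\<O>\<^sub>L\<close> permits.
\<close>

text \<open>The operator \<open>M\<close> is half of sqrt d (\<sigma> - \<sigma>^3) on the span of z
  and w. Its shape depends on O_L, so O_L has to be determined first, and the prime 2 is the whole
  difficulty: since d and a d are squarefree, coordinates of integral elements have denominators
  dividing 4, and which of them occur is decided by congruences modulo 4 and 8. In Cases 4 and 5 the
  lattice O_L is not the direct sum of its projections. An h in H that maps O_L to itself must then
  satisfy congruences linking its two scalars to its action on the third summand, while the form
  only controls the latter. The first two coordinates p0, q0 of the generator settle the rest: the h
  that sends it to an element with coordinates p, q has the scalars p / p0 and q / q0. With p0 and
  q0 equal to 1, 1/2 or 1/4 up to sign, these are integers satisfying exactly the congruences that
  keep O_L stable. A basis determines its determinant only up to sign; this is harmless because (u,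
  v) -> (v, -u) negates the form.\<close>

section \<open>Sums and products of algebraic integers\<close>

lemma algebraic_int_eigenvalue:
  fixes A :: "int mat"
  assumes A: "A \<in> carrier_mat n n" and "eigenvalue (map_mat of_int A) (x :: complex)"
  shows "algebraic_int x"
proof -
  have "map_mat of_int A \<in> carrier_mat n n"
    using A by simp
  then have "poly (char_poly (map_mat of_int A)) x = 0"
    using assms(2) eigenvalue_root_char_poly by blast
  then have "poly (map_poly of_int (char_poly A)) x = 0"
    by (simp add: of_int_hom.char_poly_hom[OF A])
  moreover have "lead_coeff (char_poly A) = 1"
    using degree_monic_char_poly[OF A] by simp
  ultimately show ?thesis
    by (auto simp: algebraic_int_altdef_ipoly)
qed

definition int_span :: "complex set \<Rightarrow> complex set" where
  "int_span V = {\<Sum>v\<in>V. of_int (f v) * v | f :: complex \<Rightarrow> int. True}"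

lemma int_span_add: "x \<in> int_span V \<Longrightarrow> y \<in> int_span V \<Longrightarrow> x + y \<in> int_span V"
  unfolding int_span_def
  by clarify (rule exI[of _ "\<lambda>v. _ v + _ v"], simp add: sum.distrib distrib_right)

lemma int_span_scale: "x \<in> int_span V \<Longrightarrow> of_int k * x \<in> int_span V"
  unfolding int_span_def
  by clarify (rule exI[of _ "\<lambda>v. k * _ v"], simp add: sum_distrib_left mult.assoc)

lemma int_span_0: "0 \<in> int_span V"
  unfolding int_span_def by clarify (rule exI[of _ "\<lambda>_. 0"], simp)

lemma int_span_sum: "(\<And>i. i \<in> I \<Longrightarrow> g i \<in> int_span V) \<Longrightarrow> sum g I \<in> int_span V"
  by (induction I rule: infinite_finite_induct) (auto intro: int_span_0 int_span_add)

lemma int_span_base: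
  assumes "finite V" "v \<in> V" shows "v \<in> int_span V"
proof -
  have "v = (\<Sum>u\<in>V. of_int (if u = v then 1 else 0) * u)"
    using assms by (simp add: if_distrib if_distribR cong: if_cong)
  then show ?thesis
    unfolding int_span_def mem_Collect_eq by (intro exI[of _ "\<lambda>u. if u = v then 1 else 0"]) simp
qed

lemma int_span_mult:
  assumes "\<And>v. v \<in> V \<Longrightarrow> x * v \<in> int_span V" and "y \<in> int_span V"
  shows "x * y \<in> int_span V"
proof -
  obtain f :: "complex \<Rightarrow> int" where y: "y = (\<Sum>v\<in>V. of_int (f v) * v)"
    using assms(2) unfolding int_span_def by blast
  have "x * y = (\<Sum>v\<in>V. of_int (f v) * (x * v))"
    by (simp add: y sum_distrib_left mult.left_commute)
  then show ?thesis
    using assms(1) by (auto intro!: int_span_sum int_span_scale)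
qed

text \<open>The determinant trick: the elements of \<open>V\<close>, read as a vector, form an
  eigenvector for x of the integer matrix that expresses each x * v through \<open>V\<close>. Linear
  relations inside \<open>V\<close> do no harm, since any choice of coefficients will do;
  \<open>v0\<close> makes the vector nonzero.\<close>

lemma algebraic_int_int_span:
  assumes fin: "finite V" and nz: "v0 \<in> V" "v0 \<noteq> 0"
    and mult: "\<And>v. v \<in> V \<Longrightarrow> x * v \<in> int_span V"
  shows "algebraic_int x"
proof -
  define n where "n = card V"
  obtain e where e: "bij_betw e {..<n} V"
    using ex_bij_betw_nat_finite[OF fin] by (auto simp: n_def atLeast0LessThan)
  have "\<exists>f :: complex \<Rightarrow> int. x * v = (\<Sum>u\<in>V. of_int (f u) * u)" if "v \<in> V" for v
    using mult[OF that] unfolding int_span_def by blast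
  then obtain F :: "complex \<Rightarrow> complex \<Rightarrow> int"
    where F: "\<And>v. v \<in> V \<Longrightarrow> x * v = (\<Sum>u\<in>V. of_int (F v u) * u)"
    by metis
  define A :: "int mat" where "A = mat n n (\<lambda>(i, j). F (e i) (e j))"
  define w :: "complex vec" where "w = vec n e"
  have A: "A \<in> carrier_mat n n"
    by (simp add: A_def)
  obtain i0 where i0: "i0 < n" "e i0 = v0"
    using e nz(1) by (metis bij_betw_imp_surj_on imageE lessThan_iff)
  have "w \<noteq> 0\<^sub>v n"
    using i0 nz(2) by (metis index_vec index_zero_vec(1) w_def)
  moreover have "map_mat of_int A *\<^sub>v w = x \<cdot>\<^sub>v w"
  proof (rule eq_vecI)
    fix i assume "i < dim_vec (x \<cdot>\<^sub>v w)"
    then have i: "i < n" by (simp add: w_def)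
    then have "e i \<in> V" using e by (auto simp: bij_betw_def)
    then have "x * e i = (\<Sum>j<n. of_int (F (e i) (e j)) * e j)"
      using F sum.reindex_bij_betw[OF e, of "\<lambda>u. of_int (F (e i) u) * u"] by simp
    then show "(map_mat of_int A *\<^sub>v w) $ i = (x \<cdot>\<^sub>v w) $ i"
      using i by (simp add: A_def w_def scalar_prod_def atLeast0LessThan)
  qed (simp_all add: w_def A_def)
  ultimately have "eigenvalue (map_mat of_int A) x"
    using A unfolding eigenvalue_def eigenvector_def by (intro exI[of _ w]) (auto simp: w_def)
  with A show ?thesis by (rule algebraic_int_eigenvalue)
qed

text \<open>Additive generators of Z[x, y] when x and y are roots of monic integer polynomials of
  degrees m and k.\<close>

definition power_products :: "complex \<Rightarrow> nat \<Rightarrow> complex \<Rightarrow> nat \<Rightarrow> complex set" where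
  "power_products x m y k = (\<lambda>(i, j). x ^ i * y ^ j) ` ({..<m} \<times> {..<k})"

lemma finite_power_products: "finite (power_products x m y k)"
  by (simp add: power_products_def)

lemma power_products_commute: "power_products x m y k = power_products y k x m"
  unfolding power_products_def
  by (auto simp: image_def mult.commute)

lemma algebraic_int_power_reduce:
  assumes "algebraic_int (x :: complex)"
  obtains m and f :: "nat \<Rightarrow> int" where "m > 0" "x ^ m = (\<Sum>l<m. of_int (f l) * x ^ l)"
proof -
  obtain p :: "int poly" where p: "poly (map_poly of_int p) x = 0" "lead_coeff p = 1"
    using assms by (auto simp: algebraic_int_altdef_ipoly)
  have "degree p > 0"
    using p by (intro Nat.gr0I) (auto elim!: degree_eq_zeroE)
  moreover have "(\<Sum>l\<le>degree p. of_int (coeff p l) * x ^ l) = 0"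
    using p(1) by (simp add: poly_altdef degree_map_poly coeff_map_poly)
  then have "x ^ degree p = (\<Sum>l<degree p. of_int (- coeff p l) * x ^ l)"
    using p(2) by (simp add: sum_negf lessThan_Suc_atMost[symmetric] eq_neg_iff_add_eq_0 add.commute)
  ultimately show ?thesis by (rule that)
qed

lemma power_products_mult:
  assumes red: "x ^ m = (\<Sum>l<m. of_int (f l) * x ^ l)"
    and v: "v \<in> power_products x m y k"
  shows "x * v \<in> int_span (power_products x m y k)"
proof -
  let ?V = "power_products x m y k"
  obtain i j where ij: "i < m" "j < k" "v = x ^ i * y ^ j"
    using v by (auto simp: power_products_def)
  have base: "x ^ l * y ^ j \<in> int_span ?V" if "l < m" for l
    using that ij(2) by (intro int_span_base finite_power_products) (auto simp: power_products_def)
  show ?thesis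
  proof (cases "Suc i < m")
    case True
    then show ?thesis using base[OF True] by (simp add: ij(3) mult.assoc)
  next
    case False
    \<comment> \<open>Only the top exponent i = m - 1 overflows, and \<open>red\<close> lowers x ^ m
      again.\<close>
    then have "x * v = x ^ m * y ^ j"
      using ij by (metis Suc_lessI mult.assoc power_Suc)
    also have "\<dots> = (\<Sum>l<m. of_int (f l) * (x ^ l * y ^ j))"
      by (simp add: red sum_distrib_right mult.assoc)
    finally show ?thesis
      using base by (auto intro!: int_span_sum int_span_scale)
  qed
qed

text \<open>One finite set whose integer span is stable under both x and y serves for the sum and
  the product at once.\<close>

lemma algebraic_int_add_mult:
  assumes "algebraic_int (x :: complex)" "algebraic_int y"
  shows algebraic_int_add: "algebraic_int (x + y)" and algebraic_int_mult: "algebraic_int (x * y)"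
proof -
  obtain m f where x: "m > 0" "x ^ m = (\<Sum>l<m. of_int (f l :: int) * x ^ l)"
    using algebraic_int_power_reduce[OF assms(1)] .
  obtain k g where y: "k > 0" "y ^ k = (\<Sum>l<k. of_int (g l :: int) * y ^ l)"
    using algebraic_int_power_reduce[OF assms(2)] .
  let ?V = "power_products x m y k"
  have one: "1 \<in> ?V"
    using x(1) y(1) unfolding power_products_def by (intro image_eqI[of _ _ "(0, 0)"]) auto
  have mx: "x * v \<in> int_span ?V" if "v \<in> ?V" for v
    using power_products_mult[OF x(2)] that .
  have my: "y * v \<in> int_span ?V" if "v \<in> ?V" for v
    using power_products_mult[OF y(2)] that power_products_commute by metis
  show "algebraic_int (x + y)"
  proof (rule algebraic_int_int_span[OF finite_power_products one])
    show "(x + y) * v \<in> int_span ?V" if "v \<in> ?V" for v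
      using mx[OF that] my[OF that] by (simp add: distrib_right int_span_add)
  qed simp
  show "algebraic_int (x * y)"
  proof (rule algebraic_int_int_span[OF finite_power_products one])
    show "x * y * v \<in> int_span ?V" if "v \<in> ?V" for v
      using int_span_mult[OF mx my[OF that]] by (simp add: mult.assoc)
  qed simp
qed

lemma algebraic_int_diff: "algebraic_int (x :: complex) \<Longrightarrow> algebraic_int y \<Longrightarrow> algebraic_int (x - y)"
  using algebraic_int_add[of x "- y"] by simp

section \<open>Congruences for integral elements\<close>

lemma odd_square_8:
  fixes x :: int
  assumes "odd x" obtains k where "x^2 = 8 * k + 1"
proof -
  obtain m where m: "x = 2 * m + 1" using assms by (rule oddE)
  have "even (m * (m + 1))" by simp
  then obtain k where k: "m * (m + 1) = 2 * k" by (rule evenE)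
  have "x^2 = 4 * (m * (m + 1)) + 1" by (simp add: m power2_eq_square algebra_simps)
  with k that show thesis by simp
qed

lemma four_dvd_double: "even x \<Longrightarrow> 4 dvd 2 * (x :: int)"
  by (auto elim!: evenE)

lemma odd_square_diff:
  fixes x y :: int
  assumes "odd x" "odd y" obtains k where "x^2 - y^2 = 8 * k"
proof -
  obtain i j where "x^2 = 8 * i + 1" "y^2 = 8 * j + 1"
    using odd_square_8 assms by metis
  then show thesis by (intro that[of "i - j"]) simp
qed

text \<open>The difference of two odd squares vanishes modulo 8, so 2 n x y alone must be divisible
  by 4, with x y odd.\<close>

lemma odd_prod_mod4:
  fixes m x y :: int
  assumes "odd m" "odd x" "odd y" and "m * (x^2 - y^2) + 2 * n * x * y = 4 * k"
  shows "even n"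
proof (rule ccontr)
  assume "odd n"
  then have "odd (n * x * y)" using assms by simp
  then obtain l where l: "n * x * y = 2 * l + 1" by (rule oddE)
  obtain i where i: "x^2 - y^2 = 8 * i" using odd_square_diff assms by metis
  have "m * (8 * i) + 2 * (n * x * y) = 4 * k" using assms(4) i by (simp add: mult.assoc)
  then have "8 * (m * i) + 2 * (2 * l + 1) = 4 * k" unfolding l by simp
  then show False by presburger
qed

lemma odd_sum_squares_mod4:
  fixes d :: int
  assumes "odd d" "d = x^2 + y^2" obtains e where "d = 4 * e + 1"
proof -
  have *: "\<exists>e. u^2 + v^2 = 4 * e + 1" if uv: "odd u" "even v" for u v :: int
  proof -
    obtain i where "u^2 = 8 * i + 1" using uv(1) by (rule odd_square_8)
    moreover obtain j where "v = 2 * j" using uv(2) by (rule evenE)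
    ultimately show ?thesis by (intro exI[of _ "2 * i + j^2"]) (simp add: power_mult_distrib)
  qed
  consider "odd x" "even y" | "odd y" "even x" using assms by auto
  then show thesis
    using *[of x y] *[of y x] assms(2) that by cases (auto simp: add.commute)
qed

text \<open>P, Q, R, T stand for four times the coordinates of an integral x in L, and (U + V sqrt
  d) / 2 for x x', where x' is the conjugate under \<sigma>^2 (\<open>h3\<close>,
  \<open>h4\<close>). Integrality enters through \<open>h1\<close> for (x - x') \<sigma>(x - x')
  without its odd factor a, \<open>h2\<close> for the norm of x + x', and \<open>h5\<close> for the
  norm of x x'. What remains is a 2-adic problem about integers.\<close>

context
  fixes a b0 c0 d P Q R T U V k l :: int
  assumes a: "odd a" and d: "d = b0^2 + c0^2"
    and h1: "c0 * (R^2 - T^2) - 2 * b0 * R * T = 4 * k"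
    and h2: "P^2 - d * Q^2 = 4 * l"
    and h3: "P^2 + d * Q^2 - a * d * (R^2 + T^2) = 8 * U"
    and h4: "2 * P * Q - a * (b0 * (R^2 - T^2) + 2 * c0 * R * T) = 8 * V"
    and h5: "4 dvd U^2 - d * V^2"
begin

text \<open>Here d is 2 modulo 4, and the descent by 2 runs twice, for the four numbers and for
  their halves. Whenever R and T (or their halves) would both be odd, \<open>odd_prod_mod4\<close>
  forces an odd coefficient to be even: b0 in the first round, a c0 in the second.\<close>

lemma integrality_even_d:
  assumes "odd b0" "odd c0"
  shows "4 dvd P" "4 dvd Q" "4 dvd R" "4 dvd T"
proof -
  obtain i j where "b0^2 = 8 * i + 1" "c0^2 = 8 * j + 1"
    using odd_square_8 assms by metis
  then obtain e where e: "d = 2 * (2 * e + 1)"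
    using d by (intro that[of "2 * (i + j)"]) simp
  have "even (U^2 - d * V^2)" using h5 by (meson dvd_trans even_numeral)
  then have "even U" by (simp add: e)
  then obtain U' where U': "U = 2 * U'" by (rule evenE)
  have "even V"
  proof (rule ccontr)
    assume "odd V"
    then have "odd ((2 * e + 1) * V^2)" by simp
    then obtain n where n: "(2 * e + 1) * V^2 = 2 * n + 1" by (rule oddE)
    have "4 dvd 4 * U'^2 - 2 * ((2 * e + 1) * V^2)"
      using h5 by (simp add: U' e power_mult_distrib algebra_simps)
    then show False unfolding n by presburger
  qed
  then obtain V' where V': "V = 2 * V'" by (rule evenE)
  have "even (P^2 + d * Q^2 - a * d * (R^2 + T^2))" unfolding h3 by simp
  then have "even P" by (simp add: e)
  then obtain P' where P': "P = 2 * P'" by (rule evenE)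
  have "even Q"
  proof (rule ccontr)
    assume "odd Q"
    then have "odd ((2 * e + 1) * Q^2)" by simp
    then obtain n where n: "(2 * e + 1) * Q^2 = 2 * n + 1" by (rule oddE)
    have "4 * P'^2 - 2 * ((2 * e + 1) * Q^2) = 4 * l"
      using h2 by (simp add: P' e power_mult_distrib algebra_simps)
    then show False unfolding n by presburger
  qed
  then obtain Q' where Q': "Q = 2 * Q'" by (rule evenE)
  have "even (c0 * (R^2 - T^2) - 2 * b0 * R * T)" unfolding h1 by simp
  then have RT: "even R \<longleftrightarrow> even T" using assms by simp
  have "even R"
  proof (rule ccontr)
    assume "odd R"
    then have "even (- b0)"
      using odd_prod_mod4[of c0 R T "- b0" k] RT h1 assms by simp
    with assms show False by simp
  qed
  then obtain R' T' where R': "R = 2 * R'" and T': "T = 2 * T'"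
    using RT by (metis evenE)
  have f1: "4 * U' = P'^2 + d * Q'^2 - a * d * (R'^2 + T'^2)"
    using h3 by (simp add: U' P' Q' R' T' power_mult_distrib algebra_simps)
  have f2: "4 * V' = 2 * P' * Q' - a * (b0 * (R'^2 - T'^2) + 2 * c0 * R' * T')"
    using h4 by (simp add: V' P' Q' R' T' power_mult_distrib algebra_simps)
  have "even (2 * P' * Q' - a * (b0 * (R'^2 - T'^2) + 2 * c0 * R' * T'))" unfolding f2[symmetric] by simp
  then have RT': "even R' \<longleftrightarrow> even T'" using a assms by simp
  have "even (P'^2 + d * Q'^2 - a * d * (R'^2 + T'^2))" unfolding f1[symmetric] by simp
  then have "even P'" by (simp add: e)
  then obtain P'' where P'': "P' = 2 * P''" by (rule evenE)
  have "2 * U' = 2 * P''^2 + (2 * e + 1) * (Q'^2 - a * (R'^2 + T'^2))"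
    using f1 by (simp add: P'' e power_mult_distrib algebra_simps)
  then have "even (2 * P''^2 + (2 * e + 1) * (Q'^2 - a * (R'^2 + T'^2)))"
    by (metis dvd_triv_left)
  then have "even Q'" using RT' a by simp
  then obtain Q'' where Q'': "Q' = 2 * Q''" by (rule evenE)
  have "even R'"
  proof (rule ccontr)
    assume "odd R'"
    then have "even (a * c0)"
      using odd_prod_mod4[of "a * b0" R' T' "a * c0" "2 * P'' * Q'' - V'"] RT' f2 a assms
      by (simp add: P'' Q'' algebra_simps)
    with a assms show False by simp
  qed
  with RT' \<open>even P'\<close> \<open>even Q'\<close> show "4 dvd P" "4 dvd Q" "4 dvd R" "4 dvd T"
    by (auto simp: P' Q' R' T')
qed

context
  assumes odd_d: "odd d"
begin

lemma parity_PQ: "even P \<longleftrightarrow> even Q"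
proof -
  have "even (P^2 - d * Q^2)" unfolding h2 by simp
  then show ?thesis using odd_d by simp
qed

lemma parity_RT: "even R \<longleftrightarrow> even T"
proof -
  have "even (P^2 + d * Q^2 - a * d * (R^2 + T^2))" unfolding h3 by simp
  then show ?thesis using odd_d a parity_PQ by simp
qed

lemma parity_UV: "even U \<longleftrightarrow> even V"
proof -
  have "even (U^2 - d * V^2)" using h5 by (meson dvd_trans even_numeral)
  then show ?thesis using odd_d by simp
qed

text \<open>With R and T even, \<open>h3\<close> modulo 4 leaves P^2 + d Q^2, and this would be 2
  modulo 4 for odd P and Q, as d is 1 modulo 4.\<close>

lemma halves:
  assumes "even R"
  obtains P' Q' R' T' where "P = 2 * P'" "Q = 2 * Q'" "R = 2 * R'" "T = 2 * T'"
    "2 * U = P'^2 + d * Q'^2 - a * d * (R'^2 + T'^2)"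
    "2 * V = 2 * P' * Q' - a * (b0 * (R'^2 - T'^2) + 2 * c0 * R' * T')"
proof -
  obtain R' T' where R': "R = 2 * R'" and T': "T = 2 * T'"
    using assms parity_RT by (metis evenE)
  have "even P"
  proof (rule ccontr)
    assume "odd P"
    with parity_PQ obtain i j where "P^2 = 8 * i + 1" and j: "Q^2 = 8 * j + 1"
      using odd_square_8 by metis
    moreover obtain e where "d = 4 * e + 1" by (rule odd_sum_squares_mod4[OF odd_d d])
    ultimately have "8 * i + 1 + (8 * (d * j) + (4 * e + 1)) - 4 * (a * d * (R'^2 + T'^2)) = 8 * U"
      using h3 by (simp add: R' T' power_mult_distrib algebra_simps)
    then show False by presburger
  qed
  with parity_PQ obtain P' Q' where "P = 2 * P'" "Q = 2 * Q'"
    by (metis evenE)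
  with R' T' show thesis
    using h3 h4 by (intro that[of P' Q' R' T']) (simp_all add: power_mult_distrib algebra_simps)
qed

lemma integrality_odd_b0:
  assumes "odd b0" "even c0"
  shows "2 dvd P" "2 dvd Q" "4 dvd P - Q" "4 dvd R" "4 dvd T"
proof -
  have "even R"
  proof (rule ccontr)
    assume "odd R"
    with parity_RT have "odd (R * T)" by simp
    then have "odd (b0 * R * T)" using assms by simp
    then obtain n where n: "b0 * R * T = 2 * n + 1" by (rule oddE)
    obtain j where "R^2 - T^2 = 8 * j" using odd_square_diff \<open>odd R\<close> parity_RT by metis
    then have "8 * (c0 * j) - 2 * (b0 * R * T) = 4 * k" using h1 by simp
    then show False unfolding n by presburger
  qed
  then obtain P' Q' R' T' where defs: "P = 2 * P'" "Q = 2 * Q'" "R = 2 * R'" "T = 2 * T'"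
    and f1: "2 * U = P'^2 + d * Q'^2 - a * d * (R'^2 + T'^2)"
    and f2: "2 * V = 2 * P' * Q' - a * (b0 * (R'^2 - T'^2) + 2 * c0 * R' * T')"
    by (rule halves)
  have "even (2 * P' * Q' - a * (b0 * (R'^2 - T'^2) + 2 * c0 * R' * T'))"
    unfolding f2[symmetric] by simp
  then have RT: "even R' \<longleftrightarrow> even T'" using a assms by simp
  have "even (P'^2 + d * Q'^2 - a * d * (R'^2 + T'^2))" unfolding f1[symmetric] by simp
  then have PQ: "even P' \<longleftrightarrow> even Q'" using a odd_d RT by simp
  obtain e where e: "d = 4 * e + 1" by (rule odd_sum_squares_mod4[OF odd_d d])
  \<comment> \<open>If R' were odd, V would have the parity of P' and U the opposite one, against
    \<open>parity_UV\<close>.\<close>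
  have "even R'"
  proof (rule ccontr)
    assume R: "odd R'"
    with RT obtain i j where ij: "R'^2 = 8 * i + 1" "T'^2 = 8 * j + 1"
      using odd_square_8 by metis
    obtain c1 where c1: "c0 = 2 * c1" using assms by (metis evenE)
    have V: "V = P' * Q' - a * (4 * b0 * (i - j) + 2 * c1 * R' * T')"
      using f2 by (simp add: ij c1 algebra_simps)
    have parV: "even V \<longleftrightarrow> even P'" unfolding V using PQ by simp
    show False
    proof (cases "even P'")
      case True
      with PQ obtain x y where xy: "P' = 2 * x" "Q' = 2 * y" by (metis evenE)
      have "U = 2 * x^2 + 2 * d * y^2 - a * d * (4 * i + 4 * j + 1)"
        using f1 by (simp add: ij xy power_mult_distrib algebra_simps)
      then have "odd U" using a odd_d by simp
      with parV True parity_UV show False by simp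
    next
      case False
      with PQ obtain x y where xy: "P'^2 = 8 * x + 1" "Q'^2 = 8 * y + 1"
        using odd_square_8 by metis
      have "2 * U = 8 * x + 1 + (8 * (d * y) + (4 * e + 1)) - 2 * (a * d * (4 * i + 4 * j + 1))"
        using f1 by (simp add: ij xy algebra_simps e)
      then have "U = 4 * x + 4 * (d * y) + 2 * e + 1 - a * d * (4 * i + 4 * j + 1)" by simp
      then have "even U" using a odd_d by simp
      with parV False parity_UV show False by simp
    qed
  qed
  with RT have "even T'" by simp
  with \<open>even R'\<close> PQ defs show "2 dvd P" "2 dvd Q" "4 dvd P - Q" "4 dvd R" "4 dvd T"
    using four_dvd_double[of "P' - Q'"] four_dvd_double[of R'] four_dvd_double[of T']
    by (simp_all add: right_diff_distrib)
qed

text \<open>This is the only way for a denominator 4 to occur at z and w. All four numbers are then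
  odd with squares 1 modulo 8, so \<open>h3\<close> becomes a condition on a and b0 modulo 4, and
  \<open>h4\<close> fixes P Q modulo 4.\<close>

lemma odd_R_imp:
  assumes "odd R" "even b0" "odd c0"
  shows "odd P" "[a + b0 = 1] (mod 4)" "\<exists>n. P * Q = a * c0 * R * T + 4 * n"
proof -
  obtain i j where ij: "R^2 = 8 * i + 1" "T^2 = 8 * j + 1"
    using odd_square_8 assms parity_RT by metis
  obtain e where e: "d = 4 * e + 1" by (rule odd_sum_squares_mod4[OF odd_d d])
  have h3': "P^2 + d * Q^2 - 2 * (a * d * (4 * i + 4 * j + 1)) = 8 * U"
    using h3 by (simp add: ij algebra_simps)
  show P: "odd P"
  proof
    assume "even P"
    with parity_PQ obtain x y where xy: "P = 2 * x" "Q = 2 * y" by (metis evenE)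
    have "odd (a * d * (4 * i + 4 * j + 1))" using a odd_d by simp
    then obtain n where n: "a * d * (4 * i + 4 * j + 1) = 2 * n + 1" by (rule oddE)
    have "4 * x^2 + 4 * (d * y^2) - 2 * (a * d * (4 * i + 4 * j + 1)) = 8 * U"
      using h3' by (simp add: xy power_mult_distrib)
    then show False unfolding n by presburger
  qed
  with parity_PQ obtain x y where xy: "P^2 = 8 * x + 1" "Q^2 = 8 * y + 1"
    using odd_square_8 by metis
  obtain f where f: "b0 = 2 * f" using assms by (metis evenE)
  obtain g where g: "c0^2 = 8 * g + 1" using assms odd_square_8 by metis
  have df: "d = 8 * g + 1 + 4 * f^2" by (simp add: d f g power_mult_distrib)
  show "[a + b0 = 1] (mod 4)"
  proof -
    have "8 * x + 1 + 8 * (d * y) + (8 * g + 1 + 4 * f^2)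
        - 2 * (a * (8 * g + 1 + 4 * f^2)) - 8 * (a * d * (i + j)) = 8 * U"
      using h3' by (simp add: xy algebra_simps df)
    then have "4 * x + 1 + 4 * (d * y) + (4 * g + 2 * f^2)
        - a - 8 * (a * g) - 4 * (a * f^2) - 4 * (a * d * (i + j)) = 4 * U"
      by (simp add: algebra_simps)
    \<comment> \<open>As f^2 and f have the same parity, 2 f^2 may be replaced by 2 f = b0 modulo
      4.\<close>
    moreover have "even (f^2 - f)" by simp
    then obtain m where "f^2 - f = 2 * m" by (rule evenE)
    then have "f^2 = f + 2 * m" by simp
    ultimately have "a + b0 - 1 = 4 * (x + d * y + g + f + m - 2 * (a * g) - a * f^2 - a * d * (i + j) - U)"
      by (simp add: f)
    then show ?thesis by (metis cong_iff_dvd_diff dvd_triv_left)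
  qed
  have "2 * (P * Q) = 8 * V + a * b0 * (8 * (i - j)) + 2 * (a * c0 * R * T)"
    using h4 by (simp add: ij algebra_simps)
  then have "P * Q = a * c0 * R * T + 4 * (V + a * b0 * (i - j))" by (simp add: algebra_simps)
  then show "\<exists>n. P * Q = a * c0 * R * T + 4 * n" by blast
qed

lemma even_R_imp:
  assumes "even R" "even b0" "odd c0"
  shows "even P" "4 dvd P - Q - R + T"
    and "\<not> [a + b0 = 1] (mod 4) \<Longrightarrow> 4 dvd R - T"
proof -
  obtain P' Q' R' T' where defs: "P = 2 * P'" "Q = 2 * Q'" "R = 2 * R'" "T = 2 * T'"
    and f1: "2 * U = P'^2 + d * Q'^2 - a * d * (R'^2 + T'^2)"
    and f2: "2 * V = 2 * P' * Q' - a * (b0 * (R'^2 - T'^2) + 2 * c0 * R' * T')"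
    using assms(1) by (rule halves)
  have "even (P'^2 + d * Q'^2 - a * d * (R'^2 + T'^2))" unfolding f1[symmetric] by simp
  then have par: "even (P' - Q' - R' + T')" using a odd_d by auto
  show "even P" using defs by simp
  show "4 dvd P - Q - R + T"
    using four_dvd_double[OF par] defs by (simp add: algebra_simps)
  assume nc: "\<not> [a + b0 = 1] (mod 4)"
  \<comment> \<open>If R' - T' were odd, V would have the parity of b0 / 2 and U that of (1 - a) /
    2; \<open>parity_UV\<close> then yields the excluded congruence.\<close>
  have "even (R' - T')"
  proof (rule ccontr)
    assume odd: "odd (R' - T')"
    obtain f where f: "b0 = 2 * f" using assms by (metis evenE)
    obtain e where e: "d = 4 * e + 1" by (rule odd_sum_squares_mod4[OF odd_d d])
    have sq: "\<exists>n. x^2 + y^2 = 4 * n + 1" if "odd (x - y)" for x y :: int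
    proof (cases "even x")
      case True
      then obtain i where "x = 2 * i" by (rule evenE)
      moreover have "odd y" using that True by simp
      then obtain j where "y^2 = 8 * j + 1" by (rule odd_square_8)
      ultimately show ?thesis by (intro exI[of _ "i^2 + 2 * j"]) (simp add: power_mult_distrib)
    next
      case False
      then obtain j where "x^2 = 8 * j + 1" by (rule odd_square_8)
      moreover have "even y" using that False by simp
      then obtain i where "y = 2 * i" by (rule evenE)
      ultimately show ?thesis by (intro exI[of _ "i^2 + 2 * j"]) (simp add: power_mult_distrib)
    qed
    obtain m n where mn: "R'^2 + T'^2 = 4 * m + 1" "P'^2 + Q'^2 = 4 * n + 1"
      using sq[OF odd] sq[of P' Q'] par odd by auto
    have "2 * U = (4 * n + 1) + 4 * (e * Q'^2) - a * (4 * e + 1) * (4 * m + 1)"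
      using f1 mn by (simp add: e algebra_simps)
    then have U: "2 * U = 1 - a + 4 * (n + e * Q'^2 - a * e * (4 * m + 1) - a * m)"
      by (simp add: algebra_simps)
    have "V = P' * Q' - a * (f * (R'^2 - T'^2) + c0 * R' * T')"
      using f2 by (simp add: f algebra_simps)
    then have "even V \<longleftrightarrow> even f"
      using par odd a assms by auto
    with parity_UV have "even (U - f)" by simp
    then obtain q where "U = f + 2 * q" by (metis add.commute diff_add_cancel evenE)
    with U have "a + b0 - 1 = 4 * (n + e * Q'^2 - a * e * (4 * m + 1) - a * m - q)"
      by (simp add: f)
    then have "[a + b0 = 1] (mod 4)" by (metis cong_iff_dvd_diff dvd_triv_left)
    with nc show False ..
  qed
  then show "4 dvd R - T"
    using four_dvd_double defs by (metis right_diff_distrib)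
qed

end

end

section \<open>The cyclic quartic field\<close>

text \<open>The square of the reduced denominator of x has to divide m.\<close>

lemma squarefree_rat_square:
  fixes x :: rat
  assumes "squarefree m" and "of_int m * x^2 \<in> \<int>"
  shows "x \<in> \<int>"
proof -
  obtain k where k: "of_int m * x^2 = of_int k"
    using assms(2) by (auto elim: Ints_cases)
  obtain u v where uv: "quotient_of x = (u, v)" by fastforce
  then have v: "v > 0" and cop: "coprime u v" and x: "x = of_int u / of_int v"
    using quotient_of_denom_pos quotient_of_coprime quotient_of_div by blast+
  have "of_int (m * u^2) = (of_int (k * v^2) :: rat)"
    using k v by (simp add: x field_simps)
  then have "m * u^2 = k * v^2" by (simp only: of_int_eq_iff)
  then have "v^2 dvd m * u^2" by simp
  moreover have "coprime (v^2) (u^2)" using cop by (simp add: coprime_commute)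
  ultimately have "v^2 dvd m" by (simp add: coprime_dvd_mult_left_iff)
  then have "v dvd 1" using assms(1) squarefreeD by blast
  with v have "v = 1" by simp
  then show ?thesis by (simp add: x)
qed

lemma algebraic_int_of_rat:
  assumes "algebraic_int (of_rat q :: complex)"
  shows "q \<in> \<int>"
proof -
  have "(of_rat q :: complex) \<in> \<int>"
    using assms by (intro rational_algebraic_int_is_int) auto
  then obtain k where "(of_rat q :: complex) = of_int k" by (auto elim: Ints_cases)
  then have "(of_rat q :: complex) = of_rat (of_int k)" by simp
  then have "q = of_int k" by (simp only: of_rat_eq_iff)
  then show ?thesis by simp
qed

lemma algebraic_int_square: "algebraic_int ((x :: complex)^2) \<Longrightarrow> algebraic_int x"
  by (rule algebraic_int_root[of "x^2" "monom 1 2"])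
     (auto simp: poly_monom degree_monom_eq)

text \<open>The polynomial is the norm from Z[\<theta>] of X^2 + m - \<theta> (X - v): with A = X^2
  + m and B = X - v it equals A^2 - A B - e B^2.\<close>

lemma algebraic_int_quadratic:
  fixes \<theta> x :: complex
  assumes "\<theta>^2 = \<theta> + of_int e" and "x^2 + of_int m = \<theta> * (x - of_int v)"
  shows "algebraic_int x"
proof -
  let ?p = "[:m^2 + m * v - e * v^2, 2 * e * v - m, 2 * m + v - e, -1, 1:]"
  let ?y = "x - of_int v"
  have "poly (map_poly of_int ?p) x
      = (x^2 + of_int m)^2 - (x^2 + of_int m) * ?y - of_int e * ?y^2"
    by (simp add: map_poly_pCons algebra_simps power2_eq_square)
  also have "\<dots> = 0"
    unfolding assms(2) using assms(1) by (simp add: power_mult_distrib) (simp add: algebra_simps power2_eq_square)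
  finally show ?thesis
    unfolding algebraic_int_altdef_ipoly by (intro exI[of _ ?p]) simp
qed

lemma is_subfield_hull: "is_subfield (is_subfield hull S)"
  by (rule hull_in) (fastforce simp: is_subfield_def)

lemma is_subfieldD:
  assumes "is_subfield K"
  shows "0 \<in> K" "1 \<in> K" "x \<in> K \<Longrightarrow> y \<in> K \<Longrightarrow> x - y \<in> K" "x \<in> K \<Longrightarrow> y \<in> K \<Longrightarrow> x + y \<in> K"
    "x \<in> K \<Longrightarrow> y \<in> K \<Longrightarrow> x * y \<in> K" "x \<in> K \<Longrightarrow> y \<in> K \<Longrightarrow> x / y \<in> K" "of_rat q \<in> K"
proof -
  show 1: "1 \<in> K" and diff: "x \<in> K \<Longrightarrow> y \<in> K \<Longrightarrow> x - y \<in> K" for x y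
    using assms by (auto simp: is_subfield_def)
  show 0: "0 \<in> K" using diff[OF 1 1] by simp
  show add: "x \<in> K \<Longrightarrow> y \<in> K \<Longrightarrow> x + y \<in> K" for x y
    using diff[of x "0 - y"] diff[OF 0, of y] by simp
  show "x \<in> K \<Longrightarrow> y \<in> K \<Longrightarrow> x * y \<in> K"
    using assms by (auto simp: is_subfield_def)
  show div: "x \<in> K \<Longrightarrow> y \<in> K \<Longrightarrow> x / y \<in> K" for x y
    using assms by (simp add: is_subfield_def divide_inverse)
  have nat: "of_nat k \<in> K" for k
    by (induction k) (auto intro: 0 1 add)
  have int: "of_int k \<in> K" for k
    using nat diff[OF 0 nat] by (cases k rule: int_cases2) auto
  show "of_rat q \<in> K"
    by (cases q) (auto simp: of_rat_rat intro: div int)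
qed

locale cyclic_quartic =
  fixes a b0 c0 d :: int and \<sigma> :: "complex \<Rightarrow> complex"
  assumes odd_a: "odd a" and sqf_a: "squarefree a"
    and b0_pos: "b0 > 0" and c0_pos: "c0 > 0"
    and d_eq: "d = b0^2 + c0^2" and sqf_d: "squarefree d" and coprime_ad: "coprime a d"
    and galois: "\<sigma> \<in> galois_group (adjoin (gen_z a b0 d))"
    and \<sigma>_gen_z: "\<sigma> (gen_z a b0 d) = gen_w a b0 d"
    and \<sigma>_gen_w: "\<sigma> (gen_w a b0 d) = - gen_z a b0 d"
begin

abbreviation "s \<equiv> sqrt_d d"
abbreviation "z \<equiv> gen_z a b0 d"
abbreviation "w \<equiv> gen_w a b0 d"
abbreviation "L \<equiv> adjoin z"

section \<open>Multiplicative relations among sqrt d, z and w\<close>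

lemma d_pos: "d > 0"
  using b0_pos by (simp add: d_eq add_pos_nonneg)

lemma a_nonzero: "a \<noteq> 0"
  using odd_a by auto

lemma s_sq: "s * s = of_int d"
  using d_pos by (simp add: sqrt_d_def flip: of_real_mult)

lemma z_sq: "z * z = of_int a * (of_int d + of_int b0 * s)"
  by (simp add: gen_z_def flip: power2_eq_square)

lemma w_sq: "w * w = of_int a * (of_int d - of_int b0 * s)"
  by (simp add: gen_w_def flip: power2_eq_square)

text \<open>Both radicands are a times a positive real number. For a < 0 both principal roots are
  therefore positive multiples of the imaginary unit, whose square contributes exactly the sign of
  a.\<close>

lemma zw_and_nonzero: "z * w = of_int a * of_int c0 * s" and z_nonzero: "z \<noteq> 0" and w_nonzero: "w \<noteq> 0"
proof -
  define \<rho> where "\<rho> = sqrt (of_int d)"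
  define x y where "x = of_int d + of_int b0 * \<rho>" and "y = of_int d - of_int b0 * \<rho>"
  have \<rho>: "\<rho> > 0" "\<rho> * \<rho> = of_int d" using d_pos by (auto simp: \<rho>_def)
  have "of_int b0 * \<rho> > 0" using \<rho> b0_pos by simp
  then have x: "x > 0" using d_pos by (simp add: x_def add_pos_pos)
  have xy: "x * y = (of_int c0 * \<rho>)^2"
  proof -
    have "x * y = (of_int d)^2 - (of_int b0)^2 * (\<rho> * \<rho>)"
      by (simp add: x_def y_def algebra_simps power2_eq_square)
    also have "\<dots> = (of_int c0)^2 * of_int d"
      by (simp add: \<rho>(2)) (simp add: d_eq algebra_simps power2_eq_square)
    finally show ?thesis by (simp add: power_mult_distrib power2_eq_square \<rho>(2))
  qed
  moreover have "(of_int c0 * \<rho>)^2 > 0" using \<rho> c0_pos by simp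
  ultimately have y: "y > 0" using x by (metis zero_less_mult_pos)
  have s: "s = of_real \<rho>" by (simp add: sqrt_d_def \<rho>_def)
  have z: "z = csqrt (of_real (of_int a * x))" and w: "w = csqrt (of_real (of_int a * y))"
    by (simp_all add: gen_z_def gen_w_def x_def y_def s)
  show "z \<noteq> 0" "w \<noteq> 0" using x y a_nonzero by (simp_all add: z w)
  have sqrt: "sqrt (\<bar>of_int a\<bar> * x) * sqrt (\<bar>of_int a\<bar> * y) = \<bar>of_int a\<bar> * (of_int c0 * \<rho>)"
  proof -
    have "(\<bar>of_int a\<bar> * x) * (\<bar>of_int a\<bar> * y) = \<bar>of_int a\<bar>^2 * (x * y)"
      by (simp add: power2_eq_square algebra_simps)
    also have "\<dots> = (\<bar>of_int a\<bar> * (of_int c0 * \<rho>))^2"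
      by (simp only: xy power_mult_distrib)
    finally have "sqrt (\<bar>of_int a\<bar> * x) * sqrt (\<bar>of_int a\<bar> * y) = \<bar>\<bar>of_int a\<bar> * (of_int c0 * \<rho>)\<bar>"
      by (simp only: real_sqrt_mult[symmetric] real_sqrt_abs)
    then show ?thesis using \<rho> c0_pos by (simp only: abs_mult) simp
  qed
  show "z * w = of_int a * of_int c0 * s"
  proof (cases "a > 0")
    case True
    then have "z = of_real (sqrt (\<bar>of_int a\<bar> * x))" "w = of_real (sqrt (\<bar>of_int a\<bar> * y))"
      using x y by (simp_all add: z w csqrt_of_real_nonneg del: of_real_mult)
    then have "z * w = of_real (\<bar>of_int a\<bar> * (of_int c0 * \<rho>))"
      by (simp only: sqrt of_real_mult[symmetric])
    then show ?thesis using True by (simp add: s)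
  next
    case False
    then have "a < 0" using a_nonzero by simp
    then have "z = \<i> * of_real (sqrt (\<bar>of_int a\<bar> * x))" "w = \<i> * of_real (sqrt (\<bar>of_int a\<bar> * y))"
      using x y by (simp_all add: z w csqrt_of_real_nonpos mult_nonpos_nonneg abs_mult del: of_real_mult)
    then have "z * w = (\<i> * \<i>) * of_real (sqrt (\<bar>of_int a\<bar> * x) * sqrt (\<bar>of_int a\<bar> * y))"
      by (simp only: of_real_mult mult_ac)
    then have "z * w = - of_real (\<bar>of_int a\<bar> * (of_int c0 * \<rho>))"
      by (simp only: sqrt i_squared mult_minus1)
    then show ?thesis using \<open>a < 0\<close> by (simp add: s)
  qed
qed

text \<open>Multiplication by z reduces everything to known products, and z cancels. Together with
  \<open>s_w\<close> this makes the rational span of 1, s, z, w closed under multiplication.\<close>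

lemma s_z: "s * z = of_int b0 * z + of_int c0 * w"
proof -
  have "(s * z - of_int b0 * z - of_int c0 * w) * z
      = (s - of_int b0) * (z * z) - of_int c0 * (z * w)"
    by (simp add: algebra_simps)
  also have "\<dots> = of_int a * (of_int b0 * (s * s) + s * of_int (d - b0^2 - c0^2) - of_int b0 * of_int d)"
    unfolding z_sq zw_and_nonzero by (simp add: algebra_simps power2_eq_square)
  also have "\<dots> = 0" by (simp add: s_sq) (simp add: d_eq)
  finally have "s * z - of_int b0 * z - of_int c0 * w = 0"
    using z_nonzero by (simp only: mult_eq_0_iff simp_thms)
  then show ?thesis by (simp add: algebra_simps)
qed

lemma s_w: "s * w = of_int c0 * z - of_int b0 * w"
proof -
  have "(s * w - of_int c0 * z + of_int b0 * w) * w
      = (s + of_int b0) * (w * w) - of_int c0 * (z * w)"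
    by (simp add: algebra_simps)
  also have "\<dots> = of_int a * (s * of_int (d - b0^2 - c0^2) + of_int b0 * of_int d - of_int b0 * (s * s))"
    unfolding w_sq zw_and_nonzero by (simp add: algebra_simps power2_eq_square)
  also have "\<dots> = 0" by (simp add: s_sq) (simp add: d_eq)
  finally have "s * w - of_int c0 * z + of_int b0 * w = 0"
    using w_nonzero by (simp only: mult_eq_0_iff simp_thms)
  then show ?thesis by (simp add: algebra_simps)
qed

section \<open>L as the rational span of 1, sqrt d, z, w\<close>

definition elt :: "rat \<Rightarrow> rat \<Rightarrow> rat \<Rightarrow> rat \<Rightarrow> complex" where
  "elt p q r t = of_rat p + of_rat q * s + of_rat r * z + of_rat t * w"

lemma elt_add: "elt p q r t + elt p' q' r' t' = elt (p + p') (q + q') (r + r') (t + t')"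
  by (simp add: elt_def of_rat_add algebra_simps)

lemma elt_diff: "elt p q r t - elt p' q' r' t' = elt (p - p') (q - q') (r - r') (t - t')"
  by (simp add: elt_def of_rat_diff algebra_simps)

lemma elt_scale: "of_rat k * elt p q r t = elt (k * p) (k * q) (k * r) (k * t)"
  by (simp add: elt_def of_rat_mult algebra_simps)

lemma elt_rat: "elt p 0 0 0 = of_rat p"
  by (simp add: elt_def)

lemma elt_mult: "elt p q r t * elt p' q' r' t' = elt
    (p * p' + of_int d * (q * q') + of_int (a * d) * (r * r' + t * t'))
    (p * q' + q * p' + of_int (a * b0) * (r * r' - t * t') + of_int (a * c0) * (r * t' + t * r'))
    (p * r' + r * p' + of_int b0 * (q * r' + r * q') + of_int c0 * (q * t' + t * q'))
    (p * t' + t * p' + of_int c0 * (q * r' + r * q') - of_int b0 * (q * t' + t * q'))"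
proof -
  have "(x + y * s + u * z + v * w) * (x' + y' * s + u' * z + v' * w)
      = x * x' + (x * y' + y * x') * s + (x * u' + u * x') * z + (x * v' + v * x') * w
        + y * y' * (s * s) + u * u' * (z * z) + v * v' * (w * w) + (u * v' + v * u') * (z * w)
        + (y * u' + u * y') * (s * z) + (y * v' + v * y') * (s * w)" for x y u v x' y' u' v' :: complex
    by (simp add: algebra_simps)
  note expand = this
  show ?thesis
    unfolding elt_def expand s_sq z_sq w_sq zw_and_nonzero s_z s_w
    by (simp add: of_rat_add of_rat_mult of_rat_diff algebra_simps)
qed

lemma s_irrational:
  assumes "of_rat p + of_rat q * s = 0"
  shows "p = 0 \<and> q = 0"
proof -
  have "q = 0"
  proof (rule ccontr)
    assume q: "q \<noteq> 0"
    then have "s = of_rat (- p / q)"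
      using assms by (simp add: of_rat_divide of_rat_minus field_simps eq_neg_iff_add_eq_0)
    then have "of_rat ((- p / q)^2) = s * s"
      by (simp only: power2_eq_square of_rat_mult)
    also have "\<dots> = of_rat (of_int d)" by (simp add: s_sq)
    finally have "of_rat ((- p / q)^2) = (of_rat (of_int d) :: complex)" .
    then have sq: "(- p / q)^2 = of_int d" by (simp only: of_rat_eq_iff)
    then have "- p / q \<in> \<int>"
      using squarefree_rat_square[of 1 "- p / q"] by simp
    then obtain k where k: "- p / q = of_int k" by (rule Ints_cases)
    have "of_int (k^2) = (of_int d :: rat)" using sq unfolding k by simp
    then have "k^2 = d" by (simp only: of_int_eq_iff)
    then have "k dvd 1" by (intro squarefreeD[OF sqf_d]) simp
    then have "\<bar>k\<bar> = 1" by simp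
    then have "d = 1" using \<open>k^2 = d\<close> power2_abs[of k] by simp
    moreover have "d \<ge> 1 + 1"
      using b0_pos c0_pos unfolding d_eq by (intro add_mono) (simp_all add: one_le_power)
    ultimately show False by simp
  qed
  with assms show ?thesis by simp
qed

lemma adjoin_eq: "L = {elt p q r t | p q r t. True}"
proof
  show "L \<subseteq> {elt p q r t | p q r t. True}" (is "_ \<subseteq> ?K")
  proof (rule hull_minimal)
    have "z = elt 0 0 1 0" by (simp add: elt_def)
    then show "{z} \<subseteq> ?K" by blast
    have one: "1 = elt 1 0 0 0" by (simp add: elt_def)
    have mult: "x * y \<in> ?K" if "x \<in> ?K" "y \<in> ?K" for x y
    proof -
      obtain p q r t p' q' r' t' where xy: "x = elt p q r t" "y = elt p' q' r' t'"
        using \<open>x \<in> ?K\<close> \<open>y \<in> ?K\<close> by blast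
      show ?thesis unfolding xy elt_mult by blast
    qed
    have inv2: "inverse (elt p q 0 0) \<in> ?K" for p q
    proof (cases "p = 0 \<and> q = 0")
      case True
      then show ?thesis by (intro CollectI exI[of _ 0]) (simp add: elt_def)
    next
      case False
      define N where "N = p^2 - of_int d * q^2"
      have prod: "elt p q 0 0 * elt p (- q) 0 0 = of_rat N"
        by (simp add: elt_mult elt_rat N_def power2_eq_square)
      have "elt p (- q) 0 0 \<noteq> 0"
        using s_irrational[of p "- q"] False by (auto simp: elt_def)
      then have "inverse (elt p q 0 0) = inverse (elt p q 0 0 * elt p (- q) 0 0) * elt p (- q) 0 0"
        by simp
      also have "\<dots> = of_rat (inverse N) * elt p (- q) 0 0"
        by (simp only: prod of_rat_inverse)
      finally have "inverse (elt p q 0 0) = of_rat (inverse N) * elt p (- q) 0 0" .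
      then show ?thesis by (auto simp: elt_scale)
    qed
    have inv: "inverse x \<in> ?K" if x_in: "x \<in> ?K" for x
    proof -
      obtain p q r t where x: "x = elt p q r t" using x_in by blast
      let ?y = "elt p q (- r) (- t)"
      show ?thesis
      \<comment> \<open>Linear independence of 1, s, z, w is only derived later, from \<sigma>, so
        \<open>?y = 0\<close> needs its own case; there x = x + ?y lies in the field generated by
        s.\<close>
      proof (cases "?y = 0")
        case True
        have "x + ?y = elt (2 * p) (2 * q) 0 0" by (simp add: x elt_add)
        with True show ?thesis using inv2 by simp
      next
        case False
        obtain u v where uv: "x * ?y = elt u v 0 0"
          by (intro that) (simp add: x elt_mult)
        have "inverse x = ?y * inverse (x * ?y)"
          using False by (cases "x = 0") (simp_all add: field_simps)
        moreover have "?y \<in> ?K" by blast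
        ultimately show ?thesis
          using mult inv2 by (metis (no_types, lifting) uv)
      qed
    qed
    have diff: "x - y \<in> ?K" if "x \<in> ?K" "y \<in> ?K" for x y
    proof -
      obtain p q r t p' q' r' t' where xy: "x = elt p q r t" "y = elt p' q' r' t'"
        using \<open>x \<in> ?K\<close> \<open>y \<in> ?K\<close> by blast
      show ?thesis unfolding xy elt_diff by blast
    qed
    have "1 \<in> ?K" unfolding one by blast
    then show "is_subfield ?K"
      unfolding is_subfield_def using mult inv diff by simp
  qed
  have K: "is_subfield L" by (rule is_subfield_hull)
  note closed = is_subfieldD[OF K]
  have z: "z \<in> L" by (rule hull_inc) simp
  have int: "of_int k \<in> L" for k using closed(7)[of "of_int k"] by simp
  have "(z * z / of_int a - of_int d) / of_int b0 \<in> L"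
    by (intro closed int z)
  moreover have "(z * z / of_int a - of_int d) / of_int b0 = s"
    using a_nonzero b0_pos by (simp add: z_sq)
  ultimately have s: "s \<in> L" by (simp only:)
  have "(s * z - of_int b0 * z) / of_int c0 \<in> L"
    by (intro closed int z s)
  moreover have "(s * z - of_int b0 * z) / of_int c0 = w"
    using c0_pos by (simp add: s_z)
  ultimately have w: "w \<in> L" by (simp only:)
  show "{elt p q r t | p q r t. True} \<subseteq> L"
    unfolding elt_def by (auto intro!: closed(4,5,7) s z w)
qed

lemma elt_in_L [simp]: "elt p q r t \<in> L"
  unfolding adjoin_eq by blast

section \<open>The Galois action and linear independence\<close>

lemma \<sigma>_add: "x \<in> L \<Longrightarrow> y \<in> L \<Longrightarrow> \<sigma> (x + y) = \<sigma> x + \<sigma> y"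
  and \<sigma>_mult: "x \<in> L \<Longrightarrow> y \<in> L \<Longrightarrow> \<sigma> (x * y) = \<sigma> x * \<sigma> y"
  and \<sigma>_rat: "\<sigma> (of_rat q) = of_rat q"
  using galois by (auto simp: galois_group_def)

lemma generators_in_L: "of_rat q \<in> L" "s \<in> L" "z \<in> L" "w \<in> L"
  using elt_in_L[of q 0 0 0] elt_in_L[of 0 1 0 0] elt_in_L[of 0 0 1 0] elt_in_L[of 0 0 0 1]
  by (simp_all add: elt_def)

lemmas L_closed = is_subfieldD(3-5)[OF is_subfield_hull[of "{z}"]]

text \<open>As z * z and w * w are linear in s with opposite coefficients, \<sigma> (z * z) = w * w
  determines the image of s.\<close>

lemma \<sigma>_s: "\<sigma> s = - s"
proof -
  have "z * z = of_rat (of_int (a * d)) + of_rat (of_int (a * b0)) * s"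
    by (simp add: z_sq of_rat_mult algebra_simps)
  then have "\<sigma> (z * z) = of_rat (of_int (a * d)) + of_rat (of_int (a * b0)) * \<sigma> s"
    using generators_in_L by (simp only: \<sigma>_add \<sigma>_mult \<sigma>_rat L_closed)
  moreover have "\<sigma> (z * z) = w * w"
    using generators_in_L by (simp only: \<sigma>_mult \<sigma>_gen_z)
  ultimately have "of_int (a * b0) * (\<sigma> s + s) = 0"
    unfolding w_sq by (simp add: of_rat_mult algebra_simps)
  then have "\<sigma> s + s = 0" using a_nonzero b0_pos by simp
  then show ?thesis by (simp add: eq_neg_iff_add_eq_0)
qed

lemma \<sigma>_elt [simp]: "\<sigma> (elt p q r t) = elt p (- q) (- t) r"
proof -
  have "\<sigma> (elt p q r t) = of_rat p + of_rat q * \<sigma> s + of_rat r * \<sigma> z + of_rat t * \<sigma> w"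
    unfolding elt_def using generators_in_L by (simp only: \<sigma>_add \<sigma>_mult \<sigma>_rat L_closed)
  then show ?thesis
    by (simp add: \<sigma>_s \<sigma>_gen_z \<sigma>_gen_w elt_def of_rat_minus)
qed

text \<open>Since \<sigma>^2 negates z and w, adding the conjugate isolates the part in the field of
  s. In the remaining relation, c0 w = (s - b0) z allows z to be cancelled, and
  \<open>s_irrational\<close> applies again.\<close>

lemma elt_eq_0:
  assumes "elt p q r t = 0" shows "p = 0 \<and> q = 0 \<and> r = 0 \<and> t = 0"
proof -
  have "\<sigma> (\<sigma> (elt p q r t)) = 0" unfolding assms using \<sigma>_rat[of 0] by simp
  then have conj: "elt p q (- r) (- t) = 0" by simp
  have "of_rat (2 * p) + of_rat (2 * q) * s = elt p q r t + elt p q (- r) (- t)"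
    by (simp only: elt_add) (simp add: elt_def)
  then have pq: "2 * p = 0 \<and> 2 * q = 0"
    by (intro s_irrational) (simp only: assms conj add_0)
  then have rt: "of_rat r * z + of_rat t * w = 0" using assms by (simp add: elt_def)
  have w: "(s - of_rat (of_int b0)) * z = of_rat (of_int c0) * w"
    using s_z by (simp add: algebra_simps)
  have "(of_rat (of_int c0 * r - of_int b0 * t) + of_rat t * s) * z
      = of_rat (of_int c0) * of_rat r * z + of_rat t * ((s - of_rat (of_int b0)) * z)"
    by (simp add: of_rat_diff of_rat_mult algebra_simps)
  also have "\<dots> = of_rat (of_int c0) * of_rat r * z + of_rat t * (of_rat (of_int c0) * w)"
    by (simp only: w)
  also have "\<dots> = of_rat (of_int c0) * (of_rat r * z + of_rat t * w)"
    by (simp add: algebra_simps)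
  finally have "(of_rat (of_int c0 * r - of_int b0 * t) + of_rat t * s) * z = 0"
    unfolding rt by simp
  then have "of_int c0 * r - of_int b0 * t = 0 \<and> t = 0"
    using z_nonzero by (intro s_irrational) simp
  with pq c0_pos show ?thesis by auto
qed

lemma elt_inject: "elt p q r t = elt p' q' r' t' \<longleftrightarrow> p = p' \<and> q = q' \<and> r = r' \<and> t = t'"
  using elt_eq_0[of "p - p'" "q - q'" "r - r'" "t - t'"] by (auto simp flip: elt_diff)

section \<open>Integrality conditions from conjugates, traces and norms\<close>

lemma algebraic_int_\<sigma>:
  assumes "x \<in> L" "algebraic_int x"
  shows "algebraic_int (\<sigma> x)"
proof -
  obtain p :: "int poly" where p: "poly (map_poly of_int p) x = 0" "lead_coeff p = 1"
    using assms(2) by (auto simp: algebraic_int_altdef_ipoly)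
  \<comment> \<open>Membership in L is carried through the induction because \<sigma> is a
    homomorphism on L only.\<close>
  have "\<sigma> (poly (map_poly of_int f) x) = poly (map_poly of_int f) (\<sigma> x)
      \<and> poly (map_poly of_int f) x \<in> L" for f :: "int poly"
  proof (induction f)
    case 0
    show ?case using \<sigma>_rat[of 0] generators_in_L(1)[of 0] by simp
  next
    case (pCons c f)
    have "\<sigma> (of_int c) = of_int c" "of_int c \<in> L"
      using \<sigma>_rat[of "of_int c"] generators_in_L(1)[of "of_int c"] by simp_all
    with pCons assms(1) show ?case
      by (simp add: map_poly_pCons \<sigma>_add \<sigma>_mult L_closed)
  qed
  then have "poly (map_poly of_int p) (\<sigma> x) = 0"
    using p(1) \<sigma>_rat[of 0] by (metis of_rat_0)
  with p(2) show ?thesis by (auto simp: algebraic_int_altdef_ipoly)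
qed

text \<open>Trace and norm give the first and the third claim; together they make d (2 v)^2 an
  integer, and d is squarefree.\<close>

lemma integral_quadratic:
  assumes "algebraic_int (elt u v 0 0)"
  shows "2 * u \<in> \<int>" "2 * v \<in> \<int>" "u^2 - of_int d * v^2 \<in> \<int>"
proof -
  have conj: "algebraic_int (elt u (- v) 0 0)"
    using algebraic_int_\<sigma>[OF elt_in_L assms] by simp
  have "algebraic_int (elt (2 * u) 0 0 0)"
    using algebraic_int_add[OF assms conj] by (simp add: elt_add)
  then show u: "2 * u \<in> \<int>" by (simp only: elt_rat algebraic_int_of_rat)
  have "algebraic_int (elt (u^2 - of_int d * v^2) 0 0 0)"
    using algebraic_int_mult[OF assms conj] by (simp add: elt_mult power2_eq_square)
  then show N: "u^2 - of_int d * v^2 \<in> \<int>" by (simp only: elt_rat algebraic_int_of_rat)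
  have "of_int d * (2 * v)^2 = (2 * u)^2 - 4 * (u^2 - of_int d * v^2)"
    by (simp add: power_mult_distrib algebra_simps)
  also have "\<dots> \<in> \<int>" by (intro Ints_diff Ints_power[OF u] Ints_mult[OF _ N]) auto
  finally show "2 * v \<in> \<int>" by (rule squarefree_rat_square[OF sqf_d])
qed

text \<open>
  With \<open>x' = \<sigma>\<^sup>2 x\<close> and \<open>D = x - x'\<close>, all conditions come from the integrality of the elements
  \<open>x + x'\<close>, \<open>x x'\<close>, \<open>D \<sigma>(D)\<close> and \<open>D\<^sup>2\<close> of \<open>\<rat>(\<surd>d)\<close>; the last two bound the denominators of
  \<open>r\<close> and \<open>t\<close>, as \<open>a d\<close> is squarefree.
\<close>

lemma integral_elt_conditions:
  assumes "algebraic_int (elt p q r t)"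
  obtains P Q R T U V k l :: int where
    "p = of_int P / 4" "q = of_int Q / 4" "r = of_int R / 4" "t = of_int T / 4"
    "c0 * (R^2 - T^2) - 2 * b0 * R * T = 4 * k"
    "P^2 - d * Q^2 = 4 * l"
    "P^2 + d * Q^2 - a * d * (R^2 + T^2) = 8 * U"
    "2 * P * Q - a * (b0 * (R^2 - T^2) + 2 * c0 * R * T) = 8 * V"
    "4 dvd U^2 - d * V^2"
proof -
  let ?x = "elt p q r t" and ?y = "elt p q (- r) (- t)"
  have y: "algebraic_int ?y"
    using algebraic_int_\<sigma>[OF _ algebraic_int_\<sigma>[OF elt_in_L assms]] by simp
  have "algebraic_int (elt (2 * p) (2 * q) 0 0)"
    using algebraic_int_add[OF assms y] by (simp add: elt_add)
  note tr = integral_quadratic[OF this]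
  define u where "u = p^2 + of_int d * q^2 - of_int (a * d) * (r^2 + t^2)"
  define v where "v = 2 * p * q - of_int a * (of_int b0 * (r^2 - t^2) + 2 * of_int c0 * r * t)"
  have "?x * ?y = elt u v 0 0"
    by (simp add: elt_mult u_def v_def power2_eq_square algebra_simps)
  then have "algebraic_int (elt u v 0 0)"
    using algebraic_int_mult[OF assms y] by simp
  note nm = integral_quadratic[OF this]
  define \<kappa> where "\<kappa> = 4 * of_int a * (of_int c0 * (r^2 - t^2) - 2 * of_int b0 * r * t)"
  define n where "n = 4 * of_int (a * d) * (r^2 + t^2)"
  define m where "m = 4 * of_int a * (of_int b0 * (r^2 - t^2) + 2 * of_int c0 * r * t)"
  have D: "algebraic_int (elt 0 0 (2 * r) (2 * t))" (is "algebraic_int ?D")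
    using algebraic_int_diff[OF assms y] by (simp add: elt_diff)
  have "?D * \<sigma> ?D = elt 0 \<kappa> 0 0"
    by (simp add: elt_mult \<kappa>_def power2_eq_square algebra_simps)
  then have \<kappa>: "algebraic_int (elt 0 \<kappa> 0 0)"
    using algebraic_int_mult[OF D algebraic_int_\<sigma>[OF elt_in_L D]] by simp
  have "elt 0 \<kappa> 0 0 * elt 0 \<kappa> 0 0 = of_rat (of_int d * \<kappa>^2)"
    by (simp add: elt_mult elt_rat[symmetric] power2_eq_square)
  then have "\<kappa> \<in> \<int>"
    using algebraic_int_mult[OF \<kappa> \<kappa>] algebraic_int_of_rat squarefree_rat_square[OF sqf_d] by metis
  have "?D * ?D = elt n m 0 0"
    by (simp add: elt_mult n_def m_def power2_eq_square algebra_simps)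
  then have "algebraic_int (elt n m 0 0)" using algebraic_int_mult[OF D D] by simp
  note nm2 = integral_quadratic(1,2)[OF this]
  \<comment> \<open>In b0 m + c0 \<kappa> the products r t cancel and 4 a d (r^2 - t^2) remains; sum
    and difference with n isolate r^2 and t^2.\<close>
  have "of_int (a * d) * (4 * r)^2 = 2 * n + (of_int b0 * (2 * m) + 2 * of_int c0 * \<kappa>)"
    by (simp add: n_def m_def \<kappa>_def d_eq algebra_simps power2_eq_square)
  moreover have "of_int (a * d) * (4 * t)^2 = 2 * n - (of_int b0 * (2 * m) + 2 * of_int c0 * \<kappa>)"
    by (simp add: n_def m_def \<kappa>_def d_eq algebra_simps power2_eq_square)
  moreover have "of_int b0 * (2 * m) + 2 * of_int c0 * \<kappa> \<in> \<int>"
    by (intro Ints_add Ints_mult[OF _ nm2(2)] Ints_mult[OF _ \<open>\<kappa> \<in> \<int>\<close>]) auto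
  ultimately have "of_int (a * d) * (4 * r)^2 \<in> \<int>" "of_int (a * d) * (4 * t)^2 \<in> \<int>"
    using nm2 by simp_all
  moreover have "squarefree (a * d)"
    using sqf_a sqf_d coprime_ad by (simp add: squarefree_mult_coprime)
  ultimately have "4 * r \<in> \<int>" "4 * t \<in> \<int>"
    using squarefree_rat_square by blast+
  then obtain R T where RT: "4 * r = of_int R" "4 * t = of_int T" by (auto elim!: Ints_cases)
  obtain P Q where PQ: "4 * p = of_int P" "4 * q = of_int Q"
    using tr(1,2) by (auto elim!: Ints_cases)
  obtain U V where UV: "2 * u = of_int U" "2 * v = of_int V"
    using nm(1,2) by (auto elim!: Ints_cases)
  have eqs: "p = of_int P / 4" "q = of_int Q / 4" "r = of_int R / 4" "t = of_int T / 4"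
      "u = of_int U / 2" "v = of_int V / 2"
    using RT PQ UV by simp_all
  obtain l where l: "(2 * p)^2 - of_int d * (2 * q)^2 = of_int l"
    using tr(3) by (auto elim: Ints_cases)
  have h2: "P^2 - d * Q^2 = 4 * l"
  proof -
    have "of_int (P^2 - d * Q^2) = (of_int (4 * l) :: rat)"
      using l by (simp add: eqs field_simps power_divide)
    then show ?thesis by (simp only: of_int_eq_iff)
  qed
  obtain j where j: "u^2 - of_int d * v^2 = of_int j"
    using nm(3) by (auto elim: Ints_cases)
  have h5: "U^2 - d * V^2 = 4 * j"
  proof -
    have "of_int (U^2 - d * V^2) = (of_int (4 * j) :: rat)"
      using j by (simp add: eqs(5,6) field_simps power_divide)
    then show ?thesis by (simp only: of_int_eq_iff)
  qed
  have h3: "P^2 + d * Q^2 - a * d * (R^2 + T^2) = 8 * U"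
  proof -
    have "of_int (P^2 + d * Q^2 - a * d * (R^2 + T^2)) = (of_int (8 * U) :: rat)"
      using u_def unfolding eqs by (simp add: field_simps power_divide)
    then show ?thesis by (simp only: of_int_eq_iff)
  qed
  have h4: "2 * P * Q - a * (b0 * (R^2 - T^2) + 2 * c0 * R * T) = 8 * V"
  proof -
    have "of_int (2 * P * Q - a * (b0 * (R^2 - T^2) + 2 * c0 * R * T)) = (of_int (8 * V) :: rat)"
      using v_def unfolding eqs by (simp add: field_simps power_divide)
    then show ?thesis by (simp only: of_int_eq_iff)
  qed
  obtain i where i: "\<kappa> = of_int i" using \<open>\<kappa> \<in> \<int>\<close> by (auto elim: Ints_cases)
  have "of_int (a * (c0 * (R^2 - T^2) - 2 * b0 * R * T)) = (of_int (4 * i) :: rat)"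
    using \<kappa>_def unfolding i eqs by (simp add: field_simps power_divide)
  then have "a * (c0 * (R^2 - T^2) - 2 * b0 * R * T) = 4 * i" by (simp only: of_int_eq_iff)
  then have "4 dvd a * (c0 * (R^2 - T^2) - 2 * b0 * R * T)" by simp
  moreover have "coprime 4 a"
    using odd_a coprime_power_left_iff[of 2 2 a] by simp
  ultimately have "4 dvd c0 * (R^2 - T^2) - 2 * b0 * R * T"
    by (simp add: coprime_dvd_mult_right_iff)
  then obtain k where h1: "c0 * (R^2 - T^2) - 2 * b0 * R * T = 4 * k" by (rule dvdE)
  show thesis
    using that[OF eqs(1-4) h1 h2 h3 h4] h5 by simp
qed

end

section \<open>The ring of integers\<close>

text \<open>For odd numbers P Q is P + Q - 1 modulo 4, so P + Q and R + T agree modulo 4; so do 2 Q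
  and 2 T, which allows the signs to be changed.\<close>

lemma odd_product_congruence:
  fixes P Q R T :: int
  assumes "odd P" "odd Q" "odd R" "odd T" "P * Q = R * T + 4 * n"
  shows "4 dvd P - Q - R + T"
proof -
  obtain p q r t where *: "P = 2 * p + 1" "Q = 2 * q + 1" "R = 2 * r + 1" "T = 2 * t + 1"
    using assms(1-4) by (metis oddE)
  then have "2 * (p * q) + p + q = 2 * (r * t) + r + t + 2 * n"
    using assms(5) by (simp add: algebra_simps)
  then have "even (p - q - r + t)" by presburger
  from four_dvd_double[OF this] show ?thesis by (simp add: * algebra_simps)
qed

text \<open>These integers feed \<open>algebraic_int_quadratic\<close> for g = (1 + s + z +
  \<epsilon> w) / 4 with c = \<epsilon> c0: comparing coefficients in g^2 + m = \<theta> (g - v)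
  yields the equations for v and m.\<close>

lemma quarter_integrality:
  fixes a b0 c d :: int
  assumes "d = b0^2 + c^2" "even b0" "[a + b0 = 1] (mod 4)" "[a = c] (mod 4)"
  obtains e m v where "d = 4 * e + 1" "1 - a * c = 4 * v" "1 + d - 2 * a * d - 8 * v = 16 * m"
proof -
  obtain f where f: "b0 = 2 * f" using assms(2) by (rule evenE)
  obtain j where j: "a = c + 4 * j"
    using assms(4) by (metis cong_iff_lin cong_sym)
  obtain l where "1 = a + b0 + 4 * l"
    using assms(3) by (metis cong_iff_lin)
  then have c: "c = 1 - 2 * f - 4 * (j + l)" using j f by simp
  define i where "i = - (j + l)"
  \<comment> \<open>The factor 16 comes from q = f modulo 2: it makes f^2 + q^2 even and f^2 - q^2
    divisible by 4.\<close>
  define q where "q = 2 * i - f"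
  have c: "c = 1 + 2 * q" using c by (simp add: q_def i_def)
  have d: "d = 4 * f^2 + (1 + 2 * q)^2" by (simp add: assms(1) f c power_mult_distrib)
  show thesis
  proof (rule that)
    show "d = 4 * (f^2 + q^2 + q) + 1" by (simp add: d power2_eq_square algebra_simps)
    show v: "1 - a * c = 4 * (- (q^2 + q) - j * c)"
      by (simp add: j c power2_eq_square algebra_simps)
    have "1 + d - 2 * a * d - 8 * (- (q^2 + q) - j * c) = d - 1 - 2 * a * d + 2 * a * c"
      using v by simp
    also have "\<dots> = 4 * f^2 - 4 * q^2 - 8 * a * (f^2 + q^2) - 16 * j * q"
      by (simp add: d j c power2_eq_square algebra_simps)
    also have "\<dots> = 16 * (i * f - i^2 - a * (f^2 + 2 * i^2 - 2 * i * f) - j * q)"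
      by (simp add: q_def power2_eq_square algebra_simps)
    finally show "1 + d - 2 * a * d - 8 * (- (q^2 + q) - j * c)
        = 16 * (i * f - i^2 - a * (f^2 + 2 * i^2 - 2 * i * f) - j * q)" .
  qed
qed

context cyclic_quartic
begin

lemma integers_iff: "x \<in> ring_of_integers L \<longleftrightarrow> (\<exists>p q r t. x = elt p q r t) \<and> algebraic_int x"
  by (auto simp: ring_of_integers_def adjoin_eq)

lemma algebraic_int_scale: "algebraic_int (x :: complex) \<Longrightarrow> algebraic_int (of_rat (of_int k) * x)"
  by (intro algebraic_int_mult) simp_all

lemma algebraic_int_basic:
  shows algebraic_int_s: "algebraic_int (elt 0 1 0 0)"
    and algebraic_int_z: "algebraic_int (elt 0 0 1 0)"
    and algebraic_int_w: "algebraic_int (elt 0 0 0 1)"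
proof -
  have s: "algebraic_int s"
    by (rule algebraic_int_square) (simp add: power2_eq_square s_sq)
  have z: "algebraic_int z"
    by (rule algebraic_int_square)
       (auto simp: power2_eq_square z_sq intro!: algebraic_int_mult algebraic_int_add s)
  have w: "algebraic_int w"
    by (rule algebraic_int_square)
       (auto simp: power2_eq_square w_sq intro!: algebraic_int_mult algebraic_int_diff s)
  show "algebraic_int (elt 0 1 0 0)" "algebraic_int (elt 0 0 1 0)" "algebraic_int (elt 0 0 0 1)"
    using s z w by (simp_all add: elt_def)
qed

lemma theta_square:
  assumes "d = 4 * e + 1"
  shows "(elt (1/2) (1/2) 0 0)^2 = elt (1/2) (1/2) 0 0 + of_int e"
proof -
  have e: "of_int e = elt (of_int e) 0 0 0" by (simp add: elt_rat)
  have "of_int d = (4 * of_int e + 1 :: rat)" using assms by simp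
  then show ?thesis
    unfolding power2_eq_square e elt_mult elt_add elt_inject by (simp add: field_simps)
qed

lemma algebraic_int_theta:
  assumes "d = 4 * e + 1"
  shows "algebraic_int (elt (1/2) (1/2) 0 0)"
proof -
  have "poly (map_poly of_int [:- e, -1, 1:]) (elt (1/2) (1/2) 0 0) = 0"
    using theta_square[OF assms] by (simp add: map_poly_pCons power2_eq_square algebra_simps)
  then show ?thesis
    unfolding algebraic_int_altdef_ipoly by (intro exI[of _ "[:- e, -1, 1:]"]) simp
qed

lemma integers_even_d:
  assumes "odd b0" "odd c0"
  shows "x \<in> ring_of_integers L \<longleftrightarrow>
    (\<exists>k1 k2 k3 k4 :: int. x = elt (of_int k1) (of_int k2) (of_int k3) (of_int k4))"
proof safe
  assume "x \<in> ring_of_integers L"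
  then obtain p q r t where x: "x = elt p q r t" and alg: "algebraic_int (elt p q r t)"
    by (auto simp: integers_iff)
  from alg obtain P Q R T U V k l :: int where
    c: "p = of_int P / 4" "q = of_int Q / 4" "r = of_int R / 4" "t = of_int T / 4"
    and "c0 * (R^2 - T^2) - 2 * b0 * R * T = 4 * k" "P^2 - d * Q^2 = 4 * l"
      "P^2 + d * Q^2 - a * d * (R^2 + T^2) = 8 * U"
      "2 * P * Q - a * (b0 * (R^2 - T^2) + 2 * c0 * R * T) = 8 * V" "4 dvd U^2 - d * V^2"
    by (rule integral_elt_conditions)
  then have "4 dvd P" "4 dvd Q" "4 dvd R" "4 dvd T"
    using integrality_even_d[of a d b0 c0] odd_a d_eq assms by metis+
  then show "\<exists>k1 k2 k3 k4 :: int. x = elt (of_int k1) (of_int k2) (of_int k3) (of_int k4)"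
    by (auto elim!: dvdE simp: x c) blast
next
  fix k1 k2 k3 k4 :: int
  have "elt (of_int k1) (of_int k2) (of_int k3) (of_int k4)
      = of_int k1 + of_rat (of_int k2) * elt 0 1 0 0
        + of_rat (of_int k3) * elt 0 0 1 0 + of_rat (of_int k4) * elt 0 0 0 1"
    by (simp add: elt_def)
  also have "algebraic_int \<dots>"
    by (intro algebraic_int_add algebraic_int_scale algebraic_int_basic algebraic_int_of_int)
  finally show "elt (of_int k1) (of_int k2) (of_int k3) (of_int k4) \<in> ring_of_integers L"
    by (auto simp: integers_iff)
qed

lemma integers_odd_b0:
  assumes "odd b0" "even c0"
  shows "x \<in> ring_of_integers L \<longleftrightarrow>
    (\<exists>k1 k2 k3 k4 :: int. x = elt (of_int k1 + of_int k2 / 2) (of_int k2 / 2) (of_int k3) (of_int k4))"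
proof safe
  have odd_d: "odd d" using assms by (simp add: d_eq)
  assume "x \<in> ring_of_integers L"
  then obtain p q r t where x: "x = elt p q r t" and alg: "algebraic_int (elt p q r t)"
    by (auto simp: integers_iff)
  from alg obtain P Q R T U V k l :: int where
    c: "p = of_int P / 4" "q = of_int Q / 4" "r = of_int R / 4" "t = of_int T / 4"
    and "c0 * (R^2 - T^2) - 2 * b0 * R * T = 4 * k" "P^2 - d * Q^2 = 4 * l"
      "P^2 + d * Q^2 - a * d * (R^2 + T^2) = 8 * U"
      "2 * P * Q - a * (b0 * (R^2 - T^2) + 2 * c0 * R * T) = 8 * V" "4 dvd U^2 - d * V^2"
    by (rule integral_elt_conditions)
  then have "2 dvd Q" "4 dvd P - Q" "4 dvd R" "4 dvd T"
    using integrality_odd_b0[of a d b0 c0] odd_a d_eq odd_d assms by metis+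
  then obtain k1 k2 k3 k4 where "P - Q = 4 * k1" "Q = 2 * k2" "R = 4 * k3" "T = 4 * k4"
    by (auto elim!: dvdE)
  then show "\<exists>k1 k2 k3 k4 :: int.
      x = elt (of_int k1 + of_int k2 / 2) (of_int k2 / 2) (of_int k3) (of_int k4)"
    by (intro exI[of _ k1] exI[of _ k2] exI[of _ k3] exI[of _ k4])
       (simp add: x c elt_inject diff_eq_eq)
next
  have odd_d: "odd d" using assms by (simp add: d_eq)
  obtain e where e: "d = 4 * e + 1"
    using odd_sum_squares_mod4[OF odd_d d_eq] .
  fix k1 k2 k3 k4 :: int
  have "elt (of_int k1 + of_int k2 / 2) (of_int k2 / 2) (of_int k3) (of_int k4)
      = of_int k1 + of_rat (of_int k2) * elt (1/2) (1/2) 0 0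
        + of_rat (of_int k3) * elt 0 0 1 0 + of_rat (of_int k4) * elt 0 0 0 1"
    by (simp add: elt_def of_rat_add of_rat_divide algebra_simps)
  also have "algebraic_int \<dots>"
    by (intro algebraic_int_add algebraic_int_scale algebraic_int_basic algebraic_int_of_int
        algebraic_int_theta[OF e])
  finally show "elt (of_int k1 + of_int k2 / 2) (of_int k2 / 2) (of_int k3) (of_int k4)
      \<in> ring_of_integers L"
    by (auto simp: integers_iff)
qed

lemma integers_half:
  assumes "even b0" "odd c0" "\<not> [a + b0 = 1] (mod 4)"
  shows "x \<in> ring_of_integers L \<longleftrightarrow>
    (\<exists>k1 k2 k3 k4 :: int. x = elt (of_int k1 + of_int k2 / 2) (of_int k2 / 2)
      ((of_int k3 + of_int k4) / 2) ((of_int k3 - of_int k4) / 2))"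
proof safe
  have odd_d: "odd d" using assms by (simp add: d_eq)
  assume "x \<in> ring_of_integers L"
  then obtain p q r t where x: "x = elt p q r t" and alg: "algebraic_int (elt p q r t)"
    by (auto simp: integers_iff)
  from alg obtain P Q R T U V k l :: int where
    c: "p = of_int P / 4" "q = of_int Q / 4" "r = of_int R / 4" "t = of_int T / 4"
    and hyps: "c0 * (R^2 - T^2) - 2 * b0 * R * T = 4 * k" "P^2 - d * Q^2 = 4 * l"
      "P^2 + d * Q^2 - a * d * (R^2 + T^2) = 8 * U"
      "2 * P * Q - a * (b0 * (R^2 - T^2) + 2 * c0 * R * T) = 8 * V" "4 dvd U^2 - d * V^2"
    by (rule integral_elt_conditions)
  have "even R"
    using odd_R_imp(2)[OF odd_a d_eq hyps odd_d] assms by blast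
  then have "even P" "4 dvd P - Q - R + T" "4 dvd R - T"
    using even_R_imp[OF odd_a d_eq hyps odd_d] assms by blast+
  moreover have "even Q"
    using parity_PQ[OF odd_a d_eq hyps odd_d] \<open>even P\<close> by blast
  ultimately obtain k1 k2 k3 k4 where k: "P - Q - R + T = 4 * k1" "Q = 2 * k2" "R = 2 * k3" "R - T = 4 * k4"
    using \<open>even R\<close> by (auto elim!: dvdE)
  then have "P = 4 * (k1 + k4) + 2 * k2" "R = 2 * ((k3 - k4) + k4)" "T = 2 * ((k3 - k4) - k4)"
    by auto
  then show "\<exists>k1 k2 k3 k4 :: int. x = elt (of_int k1 + of_int k2 / 2) (of_int k2 / 2)
      ((of_int k3 + of_int k4) / 2) ((of_int k3 - of_int k4) / 2)"
    by (intro exI[of _ "k1 + k4"] exI[of _ k2] exI[of _ "k3 - k4"] exI[of _ k4])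
       (simp add: x c elt_inject k(2))
next
  have odd_d: "odd d" using assms by (simp add: d_eq)
  obtain e where e: "d = 4 * e + 1"
    using odd_sum_squares_mod4[OF odd_d d_eq] .
  define h where "h = elt 0 0 (1/2) (1/2)"
  have "even (d - c0)" using odd_d assms by simp
  then obtain f where "d - c0 = 2 * f" by (rule evenE)
  then have "d = c0 + 2 * f" by simp
  then have f: "of_int d = (of_int c0 + 2 * of_int f :: rat)" by simp
  \<comment> \<open>As d - c0 is even, (d + c0 s) / 2 = f + c0 \<theta> is integral; a times it is
    the square of (z + w) / 2.\<close>
  have "h^2 = of_int a * (of_int f + of_rat (of_int c0) * elt (1/2) (1/2) 0 0)"
  proof -
    have "of_int a * (of_int f + of_rat (of_int c0) * elt (1/2) (1/2) 0 0)
        = of_rat (of_int a) * (elt (of_int f) 0 0 0 + of_rat (of_int c0) * elt (1/2) (1/2) 0 0)"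
      by (simp add: elt_rat)
    also have "\<dots> = h^2"
      unfolding h_def power2_eq_square elt_mult elt_scale elt_add elt_inject
      by (simp add: f field_simps)
    finally show ?thesis by simp
  qed
  also have "algebraic_int \<dots>"
    by (intro algebraic_int_mult algebraic_int_add algebraic_int_scale algebraic_int_of_int
        algebraic_int_theta[OF e])
  finally have h: "algebraic_int h" by (rule algebraic_int_square)
  then have "algebraic_int (\<sigma> h)" by (intro algebraic_int_\<sigma>) (simp_all add: h_def)
  \<comment> \<open>This is the other basis element (z - w) / 2.\<close>
  then have h': "algebraic_int (- \<sigma> h)" by simp
  fix k1 k2 k3 k4 :: int
  have "elt (of_int k1 + of_int k2 / 2) (of_int k2 / 2)
        ((of_int k3 + of_int k4) / 2) ((of_int k3 - of_int k4) / 2)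
      = of_int k1 + of_rat (of_int k2) * elt (1/2) (1/2) 0 0
        + of_rat (of_int k3) * h + of_rat (of_int k4) * (- \<sigma> h)"
    by (simp add: h_def)
       (simp add: elt_def of_rat_add of_rat_diff of_rat_minus of_rat_divide of_rat_mult field_simps)
  also have "algebraic_int \<dots>"
    by (intro algebraic_int_add algebraic_int_scale h h' algebraic_int_of_int
        algebraic_int_theta[OF e])
  finally show "elt (of_int k1 + of_int k2 / 2) (of_int k2 / 2)
        ((of_int k3 + of_int k4) / 2) ((of_int k3 - of_int k4) / 2) \<in> ring_of_integers L"
    by (auto simp: integers_iff)
qed

text \<open>The sign \<epsilon> treats Cases 4 and 5 together: passing from (c0, w) to (\<epsilon>
  c0, \<epsilon> w) reduces the second to the first.\<close>

lemma integers_quarter: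
  fixes \<epsilon> :: int
  assumes "even b0" "odd c0" "[a + b0 = 1] (mod 4)" "\<epsilon> = 1 \<or> \<epsilon> = -1" "[a = \<epsilon> * c0] (mod 4)"
  shows "x \<in> ring_of_integers L \<longleftrightarrow>
    (\<exists>k1 k2 k3 k4 :: int. x = elt (of_int k1 + of_int k2 / 2 + (of_int k3 + of_int k4) / 4)
      (of_int k2 / 2 + (of_int k3 - of_int k4) / 4)
      ((of_int k3 + of_int k4) / 4) (of_int \<epsilon> * ((of_int k3 - of_int k4) / 4)))"
    (is "_ \<longleftrightarrow> (\<exists>k1 k2 k3 k4. x = ?e k1 k2 k3 k4)")
proof safe
  have odd_d: "odd d" using assms by (simp add: d_eq)
  have \<epsilon>: "\<epsilon> * \<epsilon> = 1" "odd \<epsilon>" using assms(4) by auto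
  assume "x \<in> ring_of_integers L"
  then obtain p q r t where x: "x = elt p q r t" and alg: "algebraic_int (elt p q r t)"
    by (auto simp: integers_iff)
  from alg obtain P Q R T U V k l :: int where
    c: "p = of_int P / 4" "q = of_int Q / 4" "r = of_int R / 4" "t = of_int T / 4"
    and hyps: "c0 * (R^2 - T^2) - 2 * b0 * R * T = 4 * k" "P^2 - d * Q^2 = 4 * l"
      "P^2 + d * Q^2 - a * d * (R^2 + T^2) = 8 * U"
      "2 * P * Q - a * (b0 * (R^2 - T^2) + 2 * c0 * R * T) = 8 * V" "4 dvd U^2 - d * V^2"
    by (rule integral_elt_conditions)
  note parity = parity_PQ[OF odd_a d_eq hyps odd_d] parity_RT[OF odd_a d_eq hyps odd_d]
  define T' where "T' = \<epsilon> * T"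
  have T': "T = \<epsilon> * T'" by (simp add: T'_def mult.assoc[symmetric] \<epsilon>)
  have parT': "even T' \<longleftrightarrow> even T" using \<epsilon> by (simp add: T'_def)
  have "4 dvd P - Q - R + T' \<and> (even Q \<longleftrightarrow> even T')"
  proof (cases "even R")
    case True
    then have *: "even P" "4 dvd P - Q - R + T"
      using even_R_imp[OF odd_a d_eq hyps odd_d] assms by blast+
    have "4 dvd T' - T"
      using assms(4) parity(2) True four_dvd_double[of "- T"] by (auto simp: T'_def)
    with *(2) have "4 dvd P - Q - R + T + (T' - T)" by (rule dvd_add)
    with *(1) True parity parT' show ?thesis by (simp add: algebra_simps)
  next
    case False
    then obtain n where P: "odd P" and PQ: "P * Q = a * c0 * R * T + 4 * n"
      using odd_R_imp[OF odd_a d_eq hyps odd_d] assms by blast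
    obtain j where j: "a = \<epsilon> * c0 + 4 * j"
      using assms(5) by (metis cong_iff_lin cong_sym)
    obtain g where g: "c0^2 = 8 * g + 1" using odd_square_8 assms by metis
    have "a * c0 * R * T = (\<epsilon> * \<epsilon>) * c0^2 * R * T' + 4 * (j * c0 * R * T)"
      by (simp add: j T' power2_eq_square algebra_simps)
    then have "P * Q = R * T' + 4 * (2 * g * R * T' + j * c0 * R * T + n)"
      by (simp add: PQ \<epsilon> g algebra_simps)
    then show ?thesis
      using odd_product_congruence P False parity parT' by blast
  qed
  then obtain k1 where k1: "P - Q - R + T' = 4 * k1" and "even (Q - T')" "even (R - T')"
    using parity parT' by (auto elim: dvdE)
  from \<open>even (Q - T')\<close> obtain k2 where "Q - T' = 2 * k2" by (rule evenE)
  moreover from \<open>even (R - T')\<close> obtain k4 where "R - T' = 2 * k4" by (rule evenE)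
  ultimately have "P = 4 * k1 + 2 * k2 + R" "Q = 2 * k2 + T'" "R = T' + 2 * k4"
    using k1 by simp_all
  note this[THEN arg_cong[of _ _ "of_int :: int \<Rightarrow> rat"]]
  \<comment> \<open>The choice k3 = T' + k4 makes k3 + k4 = R and k3 - k4 = T'.\<close>
  then have "x = ?e k1 k2 (T' + k4) k4"
    unfolding x c T' elt_inject by (simp add: field_simps)
  then show "\<exists>k1 k2 k3 k4. x = ?e k1 k2 k3 k4" by blast
next
  have \<epsilon>: "\<epsilon> * \<epsilon> = 1" using assms(4) by auto
  have "d = b0^2 + (\<epsilon> * c0)^2" using assms(4) by (auto simp: d_eq)
  then obtain e m v where e: "d = 4 * e + 1" and v: "1 - a * (\<epsilon> * c0) = 4 * v"
    and m: "1 + d - 2 * a * d - 8 * v = 16 * m"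
    using quarter_integrality assms by metis
  define g where "g = elt (1/4) (1/4) (1/4) (of_int \<epsilon> / 4)"
  define g' where "g' = elt (1/4) (-1/4) (1/4) (- of_int \<epsilon> / 4)"
  let ?\<theta> = "elt (1/2) (1/2) 0 0"
  have "g^2 + of_int m = ?\<theta> * (g - of_int v)"
  proof -
    have \<epsilon>': "of_int \<epsilon> * of_int \<epsilon> = (1 :: rat)" using \<epsilon> by (metis of_int_1 of_int_mult)
    have v': "of_int a * of_int \<epsilon> * of_int c0 = (1 - 4 * of_int v :: rat)"
      using arg_cong[OF v, of "of_int :: int \<Rightarrow> rat"] by (simp add: algebra_simps)
    have m': "of_int m = (1 + of_int d - 2 * of_int a * of_int d - 8 * of_int v) / (16 :: rat)"
      using arg_cong[OF m, of "of_int :: int \<Rightarrow> rat"] by (simp add: field_simps)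
    have "g^2 + of_int m = elt (1/4) (1/4) (1/4) (of_int \<epsilon> / 4) * elt (1/4) (1/4) (1/4) (of_int \<epsilon> / 4)
        + elt (of_int m) 0 0 0"
      by (simp add: g_def power2_eq_square elt_rat)
    also have "\<dots> = ?\<theta> * (elt (1/4) (1/4) (1/4) (of_int \<epsilon> / 4) - elt (of_int v) 0 0 0)"
      unfolding elt_add elt_mult elt_diff elt_inject
      using \<epsilon>' v' m' by (simp add: field_simps)
    finally show ?thesis by (simp add: g_def elt_rat)
  qed
  then have g: "algebraic_int g"
    using algebraic_int_quadratic theta_square[OF e] by metis
  have "algebraic_int g'"
  proof -
    \<comment> \<open>The conjugating power of \<sigma> is the third one for \<epsilon> = 1 and the
      first one for \<epsilon> = -1.\<close>
    have "g' = \<sigma> (\<sigma> (\<sigma> g)) \<or> g' = \<sigma> g"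
      using assms(4) by (auto simp: g_def g'_def elt_inject)
    moreover have "g \<in> L" "\<sigma> g \<in> L" "\<sigma> (\<sigma> g) \<in> L" by (simp_all add: g_def)
    ultimately show ?thesis using g algebraic_int_\<sigma> by metis
  qed
  note g' = this
  fix k1 k2 k3 k4 :: int
  have "?e k1 k2 k3 k4 = of_int k1 + of_rat (of_int k2) * ?\<theta>
        + of_rat (of_int k3) * g + of_rat (of_int k4) * g'"
  proof -
    have k1: "of_int k1 = elt (of_int k1) 0 0 0" by (simp add: elt_rat)
    show ?thesis
      unfolding k1 g_def g'_def elt_scale elt_add elt_inject by (simp add: field_simps)
  qed
  also have "algebraic_int \<dots>"
    by (intro algebraic_int_add algebraic_int_scale g g' algebraic_int_of_int
        algebraic_int_theta[OF e])
  finally show "?e k1 k2 k3 k4 \<in> ring_of_integers L"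
    by (auto simp: integers_iff)
qed

text \<open>On the field of s, \<sigma>^2 is trivial and \<sigma> = \<sigma>^3; on the span of z and
  w, \<sigma>^2 = -1 and \<sigma> + \<sigma>^3 = 0. So the first three basis elements of H yield
  three independent scalars, and the fourth yields twice the matrix next to \<delta>.\<close>

lemma nonclassical_hopf_iff:
  "h \<in> nonclassical_hopf L \<sigma> d \<longleftrightarrow> h \<in> extensional L \<and>
    (\<exists>\<alpha> \<beta> \<gamma> \<delta>. \<forall>p q r t. h (elt p q r t) = elt (\<alpha> * p) (\<beta> * q)
      (\<gamma> * r + \<delta> * (of_int c0 * r - of_int b0 * t)) (\<gamma> * t - \<delta> * (of_int b0 * r + of_int c0 * t)))"
proof -
  define op where "op p q r t x = of_rat p * x + of_rat q * (\<sigma> ^^ 2) x + of_rat r * (\<sigma> x + (\<sigma> ^^ 3) x)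
             + of_rat t * (s * (\<sigma> x - (\<sigma> ^^ 3) x))" for p q r t x
  have op: "op p q r t (elt P Q R T) = elt ((p + q + 2 * r) * P) ((p + q - 2 * r) * Q)
      ((p - q) * R + 2 * t * (of_int c0 * R - of_int b0 * T))
      ((p - q) * T - 2 * t * (of_int b0 * R + of_int c0 * T))" for p q r t P Q R T
  proof -
    have s: "s = elt 0 1 0 0" by (simp add: elt_def)
    show ?thesis
      unfolding op_def s
      by (simp add: numeral_2_eq_2 numeral_3_eq_3 elt_add elt_diff elt_scale elt_mult elt_inject)
         (simp add: algebra_simps)
  qed
  have H: "nonclassical_hopf L \<sigma> d = {\<lambda>x\<in>L. op p q r t x | p q r t. True}"
    by (simp add: nonclassical_hopf_def op_def)
  show ?thesis
  proof
    assume "h \<in> nonclassical_hopf L \<sigma> d"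
    then obtain p q r t where "h = (\<lambda>x\<in>L. op p q r t x)" by (auto simp: H)
    then show "h \<in> extensional L \<and>
      (\<exists>\<alpha> \<beta> \<gamma> \<delta>. \<forall>p q r t. h (elt p q r t) = elt (\<alpha> * p) (\<beta> * q)
        (\<gamma> * r + \<delta> * (of_int c0 * r - of_int b0 * t)) (\<gamma> * t - \<delta> * (of_int b0 * r + of_int c0 * t)))"
      by (intro conjI exI[of _ "p + q + 2 * r"] exI[of _ "p + q - 2 * r"] exI[of _ "p - q"]
          exI[of _ "2 * t"]) (simp_all add: op)
  next
    assume "h \<in> extensional L \<and>
      (\<exists>\<alpha> \<beta> \<gamma> \<delta>. \<forall>p q r t. h (elt p q r t) = elt (\<alpha> * p) (\<beta> * q)
        (\<gamma> * r + \<delta> * (of_int c0 * r - of_int b0 * t)) (\<gamma> * t - \<delta> * (of_int b0 * r + of_int c0 * t)))"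
    then obtain \<alpha> \<beta> \<gamma> \<delta> where ext: "h \<in> extensional L"
      and h: "\<And>p q r t. h (elt p q r t) = elt (\<alpha> * p) (\<beta> * q)
        (\<gamma> * r + \<delta> * (of_int c0 * r - of_int b0 * t)) (\<gamma> * t - \<delta> * (of_int b0 * r + of_int c0 * t))"
      by blast
    \<comment> \<open>The coefficients invert \<alpha> = p + q + 2 r, \<beta> = p + q - 2 r,
      \<gamma> = p - q, \<delta> = 2 t.\<close>
    have "h = (\<lambda>x\<in>L. op ((\<alpha> + \<beta> + 2 * \<gamma>) / 4) ((\<alpha> + \<beta> - 2 * \<gamma>) / 4) ((\<alpha> - \<beta>) / 4) (\<delta> / 2) x)"
    proof (rule extensionalityI[OF ext])
      fix x assume "x \<in> L"
      then obtain p q r t where x: "x = elt p q r t" unfolding adjoin_eq by blast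
      show "h x = (\<lambda>x\<in>L. op ((\<alpha> + \<beta> + 2 * \<gamma>) / 4) ((\<alpha> + \<beta> - 2 * \<gamma>) / 4) ((\<alpha> - \<beta>) / 4) (\<delta> / 2) x) x"
        unfolding x by (simp add: h op elt_inject field_simps)
    qed simp
    then show "h \<in> nonclassical_hopf L \<sigma> d" unfolding H by blast
  qed
qed

end

section \<open>Free generators and a binary quadratic form\<close>

text \<open>
  A rational algebra acting on \<open>\<rat> \<oplus> \<rat> \<oplus> \<rat>\<^sup>2\<close> by scalars on the first two summands and by
  \<open>\<gamma> + \<delta> M\<close> with \<open>M = (m, n; n, -m)\<close> on the third one. The lattice \<open>\<Lambda>\<close> need not be compatible
  with the decomposition, but its projection to the third summand is \<open>\<int>\<^sup>2\<close>.
\<close>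

locale hopf_lattice =
  fixes E :: "rat \<Rightarrow> rat \<Rightarrow> rat \<Rightarrow> rat \<Rightarrow> complex" and m n :: int
    and L OL :: "complex set" and H :: "(complex \<Rightarrow> complex) set"
    and \<Lambda> :: "rat \<Rightarrow> rat \<Rightarrow> rat \<Rightarrow> rat \<Rightarrow> bool"
  assumes E_inject: "E p q x y = E p' q' x' y' \<longleftrightarrow> p = p' \<and> q = q' \<and> x = x' \<and> y = y'"
    and E_surj: "L = {E p q x y | p q x y. True}"
    and H_iff: "h \<in> H \<longleftrightarrow> h \<in> extensional L \<and> (\<exists>\<alpha> \<beta> \<gamma> \<delta>. \<forall>p q x y. h (E p q x y) =
      E (\<alpha> * p) (\<beta> * q) (\<gamma> * x + \<delta> * (of_int m * x + of_int n * y))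
        (\<gamma> * y + \<delta> * (of_int n * x - of_int m * y)))"
    and coprime_mn: "coprime m n" and odd_n: "odd n"
    and OL_eq: "OL = {E p q x y | p q x y. \<Lambda> p q x y}"
    and proj_ints: "\<Lambda> p q x' y' \<Longrightarrow> x' \<in> \<int> \<and> y' \<in> \<int>"
    and proj_e: "\<exists>p q. \<Lambda> p q 1 0" and proj_f: "\<exists>p q. \<Lambda> p q 0 1"
begin

lemma E_in_OL: "E p q x y \<in> OL \<longleftrightarrow> \<Lambda> p q x y"
  by (auto simp: OL_eq E_inject)

text \<open>The images of the two unit vectors show that n \<delta> and \<gamma> \<plusminus> m
  \<delta> are integers, hence also 2 m \<delta>. Oddness of n makes 2 m and n coprime and so rules
  out a half-integral \<delta>.\<close>

lemma order_parameters_int: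
  assumes h: "\<And>p q x y. h (E p q x y) = E (\<alpha> * p) (\<beta> * q)
      (\<gamma> * x + \<delta> * (of_int m * x + of_int n * y)) (\<gamma> * y + \<delta> * (of_int n * x - of_int m * y))"
    and "h ` OL \<subseteq> OL"
  shows "\<gamma> \<in> \<int>" "\<delta> \<in> \<int>"
proof -
  have pres: "\<Lambda> p q x y \<Longrightarrow> \<Lambda> (\<alpha> * p) (\<beta> * q)
      (\<gamma> * x + \<delta> * (of_int m * x + of_int n * y)) (\<gamma> * y + \<delta> * (of_int n * x - of_int m * y))" for p q x y
    using assms(2) h by (metis E_in_OL image_subset_iff)
  obtain p q where "\<Lambda> p q 1 0" using proj_e by blast
  from proj_ints[OF pres[OF this]]
  have 1: "\<gamma> + \<delta> * of_int m \<in> \<int>" "\<delta> * of_int n \<in> \<int>" by simp_all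
  obtain p q where "\<Lambda> p q 0 1" using proj_f by blast
  from proj_ints[OF pres[OF this]]
  have 2: "\<gamma> - \<delta> * of_int m \<in> \<int>" by simp
  have "\<delta> * of_int (2 * m) = (\<gamma> + \<delta> * of_int m) - (\<gamma> - \<delta> * of_int m)" by simp
  also have "\<dots> \<in> \<int>" using 1(1) 2 by (rule Ints_diff)
  finally have 3: "\<delta> * of_int (2 * m) \<in> \<int>" .
  have "coprime (2 * m) n" using coprime_mn odd_n by simp
  then obtain i j where "i * (2 * m) + j * n = 1"
    by (metis bezout_int coprime_iff_gcd_eq_1)
  then have "\<delta> = of_int i * (\<delta> * of_int (2 * m)) + of_int j * (\<delta> * of_int n)"
    by (metis (no_types) mult.commute mult.left_commute mult_1 of_int_1 of_int_add of_int_mult distrib_left)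
  also have "\<dots> \<in> \<int>" by (intro Ints_add Ints_mult[OF _ 3] Ints_mult[OF _ 1(2)]) auto
  finally show \<delta>: "\<delta> \<in> \<int>" .
  have "\<gamma> = (\<gamma> + \<delta> * of_int m) - \<delta> * of_int m" by simp
  also have "\<dots> \<in> \<int>" by (intro Ints_diff[OF 1(1)] Ints_mult[OF \<delta>]) auto
  finally show "\<gamma> \<in> \<int>" .
qed

text \<open>Projected to the third summand, the orbit of \<beta> lies in the integer span of (u, v)
  and \<open>M\<close> (u, v), and it has to contain both unit vectors.\<close>

lemma generator_imp_form:
  assumes "is_free_generator (associated_order H OL) OL \<beta>"
  obtains u v where "n * u^2 - 2 * m * u * v - n * v^2 = 1 \<or> n * u^2 - 2 * m * u * v - n * v^2 = -1"
proof -
  have "\<beta> \<in> OL" and bij: "bij_betw (\<lambda>h. h \<beta>) (associated_order H OL) OL"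
    using assms by (auto simp: is_free_generator_def)
  then obtain p0 q0 x0 y0 where "\<Lambda> p0 q0 x0 y0" and \<beta>: "\<beta> = E p0 q0 x0 y0"
    by (auto simp: OL_eq)
  then obtain u v where uv: "x0 = of_int u" "y0 = of_int v"
    using proj_ints by (metis Ints_cases)
  have hits: "\<exists>g k :: int. of_int i = (of_int g * of_int u + of_int k * (of_int m * of_int u + of_int n * of_int v) :: rat)
      \<and> of_int j = (of_int g * of_int v + of_int k * (of_int n * of_int u - of_int m * of_int v) :: rat)"
    if "\<Lambda> p q (of_int i) (of_int j)" for p q i j
  proof -
    have "E p q (of_int i) (of_int j) \<in> (\<lambda>h. h \<beta>) ` associated_order H OL"
      using that bij by (simp add: bij_betw_def E_in_OL)
    then obtain h where h: "h \<in> H" "h ` OL \<subseteq> OL" "h \<beta> = E p q (of_int i) (of_int j)"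
      by (auto simp: associated_order_def)
    then obtain \<alpha> \<beta>' \<gamma> \<delta> where act: "\<And>p q x y. h (E p q x y) = E (\<alpha> * p) (\<beta>' * q)
      (\<gamma> * x + \<delta> * (of_int m * x + of_int n * y)) (\<gamma> * y + \<delta> * (of_int n * x - of_int m * y))"
      unfolding H_iff by blast
    from order_parameters_int[OF act h(2)] obtain g k where "\<gamma> = of_int g" "\<delta> = of_int k"
      by (auto elim!: Ints_cases)
    with h(3) show ?thesis
      unfolding \<beta> act E_inject uv by (intro exI[of _ g] exI[of _ k]) auto
  qed
  obtain p q where "\<Lambda> p q (of_int 1) (of_int 0)" using proj_e by auto
  from hits[OF this] obtain g k where
    "of_int 1 = (of_int g * of_int u + of_int k * (of_int m * of_int u + of_int n * of_int v) :: rat)"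
    "of_int 0 = (of_int g * of_int v + of_int k * (of_int n * of_int u - of_int m * of_int v) :: rat)"
    by blast
  then have gk: "g * u + k * (m * u + n * v) = 1" "g * v + k * (n * u - m * v) = 0"
    by (simp_all only: of_int_eq_iff flip: of_int_add of_int_mult of_int_diff)
  obtain p q where "\<Lambda> p q (of_int 0) (of_int 1)" using proj_f by auto
  from hits[OF this] obtain g' k' where
    "of_int 0 = (of_int g' * of_int u + of_int k' * (of_int m * of_int u + of_int n * of_int v) :: rat)"
    "of_int 1 = (of_int g' * of_int v + of_int k' * (of_int n * of_int u - of_int m * of_int v) :: rat)"
    by blast
  then have gk': "g' * u + k' * (m * u + n * v) = 0" "g' * v + k' * (n * u - m * v) = 1"
    by (simp_all only: of_int_eq_iff flip: of_int_add of_int_mult of_int_diff)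
  \<comment> \<open>Multiplicativity of the 2 by 2 determinant: the form value is invertible in the
    integers.\<close>
  have "(g * k' - k * g') * (n * u^2 - 2 * m * u * v - n * v^2)
      = (g * u + k * (m * u + n * v)) * (g' * v + k' * (n * u - m * v))
        - (g * v + k * (n * u - m * v)) * (g' * u + k' * (m * u + n * v))"
    by (simp add: power2_eq_square algebra_simps)
  also have "\<dots> = 1" by (simp add: gk gk')
  finally have "n * u^2 - 2 * m * u * v - n * v^2 dvd 1" by (metis dvd_triv_right)
  then have "n * u^2 - 2 * m * u * v - n * v^2 = 1 \<or> n * u^2 - 2 * m * u * v - n * v^2 = -1"
    by (simp only: zdvd1_eq) arith
  then show thesis by (rule that)
qed

text \<open>Every y in \<open>OL\<close> is h \<beta> for exactly one h in \<open>H\<close>, because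
  p0, q0 and the determinant \<kappa> are nonzero. The real question is whether this h maps
  \<open>OL\<close> to itself; that depends on the particular lattice and is isolated in
  \<open>pres\<close>.\<close>

lemma form_imp_generator:
  fixes u v \<kappa> :: int
  assumes lat: "\<Lambda> p0 q0 (of_int u) (of_int v)" and nz: "p0 \<noteq> 0" "q0 \<noteq> 0"
    and form: "n * u^2 - 2 * m * u * v - n * v^2 = \<kappa>" and \<kappa>: "\<kappa> * \<kappa> = 1"
    and pres: "\<And>p q (g :: int) (k :: int) p' q' (i :: int) (j :: int).
      \<Lambda> p q (of_int (g * u + k * (m * u + n * v))) (of_int (g * v + k * (n * u - m * v))) \<Longrightarrow>
      \<Lambda> p' q' (of_int i) (of_int j) \<Longrightarrow>
      \<Lambda> (p / p0 * p') (q / q0 * q') (of_int (g * i + k * (m * i + n * j))) (of_int (g * j + k * (n * i - m * j)))"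
  shows "is_free_generator (associated_order H OL) OL (E p0 q0 (of_int u) (of_int v))"
    (is "is_free_generator ?A OL ?\<beta>")
proof -
  have form_rat: "(of_int n * of_int u^2 - 2 * of_int m * of_int u * of_int v - of_int n * of_int v^2 :: rat) = of_int \<kappa>"
    using arg_cong[OF form, of "of_int :: int \<Rightarrow> rat"] by simp
  have "inj_on (\<lambda>h. h ?\<beta>) ?A"
  proof (rule inj_onI)
    fix h1 h2 assume "h1 \<in> ?A" "h2 \<in> ?A" and eq: "h1 ?\<beta> = h2 ?\<beta>"
    then have H: "h1 \<in> H" "h2 \<in> H" by (auto simp: associated_order_def)
    obtain a1 b1 g1 k1 where 1: "\<And>p q x y. h1 (E p q x y) = E (a1 * p) (b1 * q)
      (g1 * x + k1 * (of_int m * x + of_int n * y)) (g1 * y + k1 * (of_int n * x - of_int m * y))"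
      using H(1) unfolding H_iff by blast
    obtain a2 b2 g2 k2 where 2: "\<And>p q x y. h2 (E p q x y) = E (a2 * p) (b2 * q)
      (g2 * x + k2 * (of_int m * x + of_int n * y)) (g2 * y + k2 * (of_int n * x - of_int m * y))"
      using H(2) unfolding H_iff by blast
    have ab: "a1 = a2" "b1 = b2" using eq nz by (simp_all add: 1 2 E_inject)
    define g k where "g = g1 - g2" and "k = k1 - k2"
    have e: "g * of_int u + k * (of_int m * of_int u + of_int n * of_int v) = 0"
      "g * of_int v + k * (of_int n * of_int u - of_int m * of_int v) = 0"
      using eq by (simp_all add: 1 2 E_inject g_def k_def algebra_simps)
    have "k * of_int \<kappa> = (g * of_int v + k * (of_int n * of_int u - of_int m * of_int v)) * of_int u
        - (g * of_int u + k * (of_int m * of_int u + of_int n * of_int v)) * of_int v"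
      unfolding form_rat[symmetric] by (simp add: power2_eq_square algebra_simps)
    then have k: "k = 0" using e \<kappa> by auto
    have "u \<noteq> 0 \<or> v \<noteq> 0" using form \<kappa> by auto
    with e k have "g = 0" by auto
    show "h1 = h2"
    proof (rule extensionalityI[of _ L])
      show "h1 \<in> extensional L" "h2 \<in> extensional L" using H by (auto simp: H_iff)
      fix x assume "x \<in> L"
      then show "h1 x = h2 x"
        using ab k \<open>g = 0\<close> by (auto simp: E_surj 1 2 g_def k_def)
    qed
  qed
  moreover have "(\<lambda>h. h ?\<beta>) ` ?A = OL"
  proof
    show "(\<lambda>h. h ?\<beta>) ` ?A \<subseteq> OL"
      using lat by (auto simp: associated_order_def E_in_OL)
    show "OL \<subseteq> (\<lambda>h. h ?\<beta>) ` ?A"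
    proof
      fix y assume "y \<in> OL"
      then obtain p q i' j' where "\<Lambda> p q i' j'" and y: "y = E p q i' j'" by (auto simp: OL_eq)
      moreover obtain i j where ij: "i' = of_int i" "j' = of_int j"
        using proj_ints[OF calculation(1)] by (auto elim!: Ints_cases)
      ultimately have lat_y: "\<Lambda> p q (of_int i) (of_int j)" by simp
      \<comment> \<open>Cramer's rule for g (u, v) + k \<open>M\<close> (u, v) = (i, j); division by
        the determinant \<kappa> is multiplication by \<kappa>.\<close>
      define g where "g = \<kappa> * ((n * u - m * v) * i - (m * u + n * v) * j)"
      define k where "k = \<kappa> * (u * j - v * i)"
      have "g * u + k * (m * u + n * v) = \<kappa> * (n * u^2 - 2 * m * u * v - n * v^2) * i"
        by (simp add: g_def k_def power2_eq_square algebra_simps)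
      then have gk1: "g * u + k * (m * u + n * v) = i" by (simp add: form \<kappa>)
      have "g * v + k * (n * u - m * v) = \<kappa> * (n * u^2 - 2 * m * u * v - n * v^2) * j"
        by (simp add: g_def k_def power2_eq_square algebra_simps)
      then have gk2: "g * v + k * (n * u - m * v) = j" by (simp add: form \<kappa>)
      obtain coords where coords: "\<And>p q x y. coords (E p q x y) = (p, q, x, y)"
      proof
        show "(THE c. E p q x y = (case c of (p', q', x', y') \<Rightarrow> E p' q' x' y')) = (p, q, x, y)" for p q x y
          by (rule the_equality) (auto simp: E_inject)
      qed
      define h where "h = (\<lambda>x\<in>L. case coords x of (p', q', x, y) \<Rightarrow> E (p / p0 * p') (q / q0 * q')
        (of_int g * x + of_int k * (of_int m * x + of_int n * y))
        (of_int g * y + of_int k * (of_int n * x - of_int m * y)))"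
      have in_L: "E p' q' x y \<in> L" for p' q' x y unfolding E_surj by blast
      have h: "h (E p' q' x y) = E (p / p0 * p') (q / q0 * q')
        (of_int g * x + of_int k * (of_int m * x + of_int n * y))
        (of_int g * y + of_int k * (of_int n * x - of_int m * y))" for p' q' x y
        unfolding h_def by (simp add: in_L coords)
      have "h \<in> H"
      proof -
        have "h \<in> extensional L" unfolding h_def by simp
        with h show ?thesis unfolding H_iff by blast
      qed
      moreover have "h ` OL \<subseteq> OL"
      proof (rule image_subsetI)
        fix x assume "x \<in> OL"
        then obtain p' q' i1 j1 where *: "\<Lambda> p' q' i1 j1" and x: "x = E p' q' i1 j1" by (auto simp: OL_eq)
        moreover obtain i2 j2 where ij2: "i1 = of_int i2" "j1 = of_int j2"
          using proj_ints[OF *] by (auto elim!: Ints_cases)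
        ultimately have "\<Lambda> p' q' (of_int i2) (of_int j2)" by simp
        from pres[OF _ this, of p q g k] lat_y
        have "\<Lambda> (p / p0 * p') (q / q0 * q') (of_int (g * i2 + k * (m * i2 + n * j2)))
            (of_int (g * j2 + k * (n * i2 - m * j2)))"
          by (simp only: gk1 gk2)
        then show "h x \<in> OL" unfolding x ij2 h E_in_OL by simp
      qed
      ultimately have "h \<in> ?A" by (simp add: associated_order_def)
      moreover have "h ?\<beta> = y"
      proof -
        have "of_int g * of_int u + of_int k * (of_int m * of_int u + of_int n * of_int v) = (of_int i :: rat)"
          "of_int g * of_int v + of_int k * (of_int n * of_int u - of_int m * of_int v) = (of_int j :: rat)"
          using gk1 gk2 by (simp_all only: of_int_eq_iff flip: of_int_add of_int_mult of_int_diff)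
        then show ?thesis unfolding h y ij E_inject using nz by simp
      qed
      ultimately show "y \<in> (\<lambda>h. h ?\<beta>) ` ?A" by blast
    qed
  qed
  moreover have "?\<beta> \<in> OL" using lat by (simp add: E_in_OL)
  ultimately show ?thesis by (simp add: is_free_generator_def bij_betw_def)
qed

end

section \<open>The lattices of the five cases\<close>

definition lat_diag :: "rat \<Rightarrow> rat \<Rightarrow> rat \<Rightarrow> rat \<Rightarrow> bool" where
  "lat_diag p q x y \<longleftrightarrow> (\<exists>k1 k2 k3 k4 :: int. p = of_int k1 \<and> q = of_int k2 \<and> x = of_int k3 \<and> y = of_int k4)"

definition lat_half :: "rat \<Rightarrow> rat \<Rightarrow> rat \<Rightarrow> rat \<Rightarrow> bool" where
  "lat_half p q x y \<longleftrightarrow> (\<exists>k1 k2 k3 k4 :: int.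
    p = of_int k1 + of_int k2 / 2 \<and> q = of_int k2 / 2 \<and> x = of_int k3 \<and> y = of_int k4)"

text \<open>Here the third and fourth basis elements have components in the field of s, so \<int>^2
  does not split off. Equivalently, x, y, 4 p, 4 q are integers with 4 q = x - y modulo 2 and 4 p =
  4 q + 2 y modulo 4.\<close>

definition lat_quarter :: "rat \<Rightarrow> rat \<Rightarrow> rat \<Rightarrow> rat \<Rightarrow> bool" where
  "lat_quarter p q x y \<longleftrightarrow> (\<exists>k1 k2 k3 k4 :: int.
    p = of_int k1 + of_int k2 / 2 + (of_int k3 + of_int k4) / 4 \<and>
    q = of_int k2 / 2 + (of_int k3 - of_int k4) / 4 \<and> x = of_int k3 \<and> y = of_int k4)"

lemma lat_diag_scale:
  assumes "lat_diag p q (of_int X) (of_int Y)" "lat_diag p' q' (of_int i) (of_int j)"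
  shows "lat_diag (p / 1 * p') (q / 1 * q') (of_int X') (of_int Y')"
proof -
  obtain k1 k2 where "p = of_int k1" "q = of_int k2" using assms(1) by (auto simp: lat_diag_def)
  moreover obtain l1 l2 where "p' = of_int l1" "q' = of_int l2" using assms(2) by (auto simp: lat_diag_def)
  ultimately show ?thesis
    unfolding lat_diag_def by (intro exI[of _ "k1 * l1"] exI[of _ "k2 * l2"] exI[of _ X'] exI[of _ Y']) simp
qed

text \<open>With p0 = q0 = 1/2 the two scalars are 2 k1 + k2 and k2. Being integers congruent modulo
  2, they preserve the part spanned by 1 and (1 + s) / 2, and \<int>^2 is a direct summand.\<close>

lemma lat_half_scale:
  assumes "lat_half p q (of_int X) (of_int Y)" "lat_half p' q' (of_int i) (of_int j)"
  shows "lat_half (p / (1/2) * p') (q / (1/2) * q') (of_int X') (of_int Y')"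
proof -
  obtain k1 k2 :: int where k: "p = of_int k1 + of_int k2 / 2" "q = of_int k2 / 2"
    using assms(1) by (auto simp: lat_half_def)
  obtain l1 l2 :: int where l: "p' = of_int l1 + of_int l2 / 2" "q' = of_int l2 / 2"
    using assms(2) by (auto simp: lat_half_def)
  have "p / (1/2) * p' = of_int (2 * k1 * l1 + k1 * l2 + k2 * l1) + of_int (k2 * l2) / 2"
    "q / (1/2) * q' = of_int (k2 * l2) / 2"
    unfolding k l by (simp_all add: field_simps)
  then show ?thesis unfolding lat_half_def by blast
qed

lemma lat_quarter_iff:
  "lat_quarter p q (of_int i) (of_int j) \<longleftrightarrow> (\<exists>k1 k2 :: int.
    4 * p = of_int (4 * k1 + 2 * k2 + i + j) \<and> 4 * q = of_int (2 * k2 + i - j))"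
proof -
  have 1: "of_int (4 * k1 + 2 * k2 + i + j) = 4 * (of_int k1 + of_int k2 / 2 + (of_int i + of_int j) / 4 :: rat)"
    and 2: "of_int (2 * k2 + i - j) = 4 * (of_int k2 / 2 + (of_int i - of_int j) / 4 :: rat)"
    for k1 k2 i j :: int
    by (simp_all add: field_simps)
  show ?thesis unfolding lat_quarter_def 1 2 mult_cancel_left by auto
qed

text \<open>Modulo 2 the matrix (m, n; n, -m) just swaps coordinates. If the scalars are \<beta> + 2
  \<tau> and \<beta>, stability of the lattice comes down to \<beta> = g + k and \<tau> = k modulo
  2, and the hypothesis on p and q supplies both.\<close>

lemma lat_quarter_scale:
  fixes \<eta> m n u v g k i j :: int
  assumes mn: "even m" "odd n" and \<eta>: "\<eta> = 1 \<or> \<eta> = -1"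
    and uv: "lat_quarter (of_int \<eta> / 4) (1/4) (of_int u) (of_int v)"
    and XY: "lat_quarter p q (of_int (g * u + k * (m * u + n * v))) (of_int (g * v + k * (n * u - m * v)))"
    and ij: "lat_quarter p' q' (of_int i) (of_int j)"
  shows "lat_quarter (p / (of_int \<eta> / 4) * p') (q / (1/4) * q')
    (of_int (g * i + k * (m * i + n * j))) (of_int (g * j + k * (n * i - m * j)))"
proof -
  define X where "X = g * u + k * (m * u + n * v)"
  define Y where "Y = g * v + k * (n * u - m * v)"
  define X' where "X' = g * i + k * (m * i + n * j)"
  define Y' where "Y' = g * j + k * (n * i - m * j)"
  obtain h1 h2 where "4 * (of_int \<eta> / 4) = (of_int (4 * h1 + 2 * h2 + u + v) :: rat)"
      "4 * (1/4) = (of_int (2 * h2 + u - v) :: rat)"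
    using uv unfolding lat_quarter_iff by blast
  then have "of_int \<eta> = (of_int (4 * h1 + 2 * h2 + u + v) :: rat)" "of_int 1 = (of_int (2 * h2 + u - v) :: rat)"
    by simp_all
  then have h: "\<eta> = 4 * h1 + 2 * h2 + u + v" "1 = 2 * h2 + u - v"
    by (simp_all only: of_int_eq_iff)
  obtain k1 k2 where k: "4 * p = of_int (4 * k1 + 2 * k2 + X + Y)" "4 * q = of_int (2 * k2 + X - Y)"
    using XY unfolding lat_quarter_iff X_def Y_def by blast
  obtain l1 l2 where l: "4 * p' = of_int (4 * l1 + 2 * l2 + i + j)" "4 * q' = of_int (2 * l2 + i - j)"
    using ij unfolding lat_quarter_iff by blast
  define \<beta> where "\<beta> = 2 * k2 + X - Y"
  have par_uv: "even u \<longleftrightarrow> odd v" using h(2) by presburger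
  have par_\<beta>: "even \<beta> \<longleftrightarrow> (even g \<longleftrightarrow> even k)"
    using mn par_uv by (auto simp: \<beta>_def X_def Y_def)
  \<comment> \<open>The sign \<eta> reveals the parity of v, hence whether \<tau> has the parity of
    Y or of X; in either case that is the parity of k.\<close>
  obtain \<tau> where \<tau>: "\<eta> * (4 * k1 + 2 * k2 + X + Y) = \<beta> + 2 * \<tau>" "even \<tau> \<longleftrightarrow> even k"
  proof (cases "\<eta> = 1")
    case True
    then have "v = - 2 * h1" using h by simp
    then have "even v" by simp
    with True show thesis
      using par_uv mn by (intro that[of "2 * k1 + Y"]) (auto simp: \<beta>_def Y_def)
  next
    case False
    then have "\<eta> = -1" using \<eta> by simp
    then have "v = - 2 * h1 - 1" using h by simp
    then have "odd v" by simp
    with \<open>\<eta> = -1\<close> show thesis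
      using par_uv mn by (intro that[of "- 2 * k1 - 2 * k2 - X"]) (auto simp: \<beta>_def X_def)
  qed
  have "even (\<beta> * (i - j) - (X' - Y'))"
    using par_\<beta> mn by (auto simp: X'_def Y'_def)
  then obtain e2 where e2: "\<beta> * (i - j) - (X' - Y') = 2 * e2" by (rule evenE)
  have "even (\<tau> * i + (\<tau> + \<beta>) * j - Y')"
    using par_\<beta> \<tau>(2) mn by (auto simp: Y'_def)
  then obtain e1 where e1: "\<tau> * i + (\<tau> + \<beta>) * j - Y' = 2 * e1" by (rule evenE)
  have "p / (of_int \<eta> / 4) = of_int \<eta> * (4 * p)" using \<eta> by auto
  also have "\<dots> = of_int (\<beta> + 2 * \<tau>)" by (simp only: k(1) \<tau>(1)[symmetric] of_int_mult)
  finally have p: "p / (of_int \<eta> / 4) = of_int (\<beta> + 2 * \<tau>)" .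
  have q: "q / (1/4) = of_int \<beta>" using k(2) by (simp add: \<beta>_def)
  have "4 * (of_int (\<beta> + 2 * \<tau>) * p') = of_int ((\<beta> + 2 * \<tau>) * (4 * l1 + 2 * l2 + i + j))"
    using l(1) by (simp only: of_int_mult mult.left_commute[of 4])
  also have "(\<beta> + 2 * \<tau>) * (4 * l1 + 2 * l2 + i + j)
      = 4 * ((\<beta> + 2 * \<tau>) * l1 + \<tau> * l2 + e1) + 2 * (\<beta> * l2 + e2) + X' + Y'"
    using e1 e2 by (simp add: algebra_simps)
  finally have P: "4 * (of_int (\<beta> + 2 * \<tau>) * p')
      = of_int (4 * ((\<beta> + 2 * \<tau>) * l1 + \<tau> * l2 + e1) + 2 * (\<beta> * l2 + e2) + X' + Y')" .
  have "4 * (of_int \<beta> * q') = of_int (\<beta> * (2 * l2 + i - j))"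
    using l(2) by (simp only: of_int_mult mult.left_commute[of 4])
  also have "\<beta> * (2 * l2 + i - j) = 2 * (\<beta> * l2 + e2) + X' - Y'"
    using e2 by (simp add: algebra_simps)
  finally have Q: "4 * (of_int \<beta> * q') = of_int (2 * (\<beta> * l2 + e2) + X' - Y')" .
  show ?thesis
    unfolding p q lat_quarter_iff X'_def[symmetric] Y'_def[symmetric] using P Q by blast
qed

text \<open>Substituting x = b U + c y turns x^2 - d y^2 into b times the form.\<close>

lemma equation_imp_form:
  fixes b c d x y U :: int
  assumes "b \<noteq> 0" "d = b^2 + c^2" "x^2 - d * y^2 = b" "x - c * y = b * U"
  shows "b * U^2 + 2 * c * U * y - b * y^2 = 1"
proof -
  have x: "x = b * U + c * y" using assms(4) by simp
  have "b * (b * U^2 + 2 * c * U * y - b * y^2) = b * 1"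
    using assms(3) by (simp add: x assms(2) power2_eq_square algebra_simps)
  then show ?thesis using assms(1) by simp
qed

lemma form_represents_iff_equation:
  fixes b c d :: int
  assumes "b \<noteq> 0" "d = b^2 + c^2"
  shows "form_represents b (2 * c) (- b) 1 \<longleftrightarrow> (\<exists>x y. x^2 - d * y^2 = b \<and> b dvd x - c * y)"
proof
  assume "form_represents b (2 * c) (- b) 1"
  then obtain U V where UV: "b * U^2 + 2 * c * U * V - b * V^2 = 1"
    by (auto simp: form_represents_def)
  have "(b * U + c * V)^2 - d * V^2 = b * (b * U^2 + 2 * c * U * V - b * V^2)"
    by (simp add: assms(2) power2_eq_square algebra_simps)
  then have "(b * U + c * V)^2 - d * V^2 = b" by (simp add: UV)
  then show "\<exists>x y. x^2 - d * y^2 = b \<and> b dvd x - c * y"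
    by (intro exI[of _ "b * U + c * V"] exI[of _ V]) simp
next
  assume "\<exists>x y. x^2 - d * y^2 = b \<and> b dvd x - c * y"
  then obtain x y where xy: "x^2 - d * y^2 = b" and "b dvd x - c * y" by blast
  then obtain U where U: "x - c * y = b * U" by (blast elim: dvdE)
  have "b * U^2 + 2 * c * U * y + - b * y^2 = 1"
    using equation_imp_form[OF assms xy U] by simp
  then show "form_represents b (2 * c) (- b) 1" unfolding form_represents_def by blast
qed

text \<open>Changing the sign of v changes the sign of the middle coefficient, and (u, v) -> (v, -u)
  negates the form, so all signs can be absorbed.\<close>

lemma form_represents_1I:
  fixes b c m n u v :: int
  assumes "n * u^2 - 2 * m * u * v - n * v^2 = 1 \<or> n * u^2 - 2 * m * u * v - n * v^2 = -1"
    and "n = b \<or> n = - b" "m = c \<or> m = - c"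
  shows "form_represents b (2 * c) (- b) 1"
proof -
  let ?F = "\<lambda>U V. b * U^2 + 2 * c * U * V + - b * V^2"
  have "?F u v = 1 \<or> ?F u (- v) = 1 \<or> ?F v u = 1 \<or> ?F v (- u) = 1"
    using assms by (auto simp: algebra_simps)
  then show ?thesis unfolding form_represents_def by blast
qed

context cyclic_quartic
begin

section \<open>Matching the field with the abstract lattices\<close>

lemma coprime_b0_c0: "coprime b0 c0"
proof -
  have "gcd b0 c0 ^ 2 dvd d" unfolding d_eq by (intro dvd_add dvd_power_same) auto
  then have "gcd b0 c0 dvd 1" using squarefreeD[OF sqf_d] by blast
  then show ?thesis by (simp add: coprime_iff_gcd_eq_1)
qed

lemma hopf_lattice_std:
  assumes "odd b0"
    and "ring_of_integers L = {elt p q x y | p q x y. \<Lambda> p q x y}"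
    and "\<And>p q x y. \<Lambda> p q x y \<Longrightarrow> x \<in> \<int> \<and> y \<in> \<int>" "\<exists>p q. \<Lambda> p q 1 0" "\<exists>p q. \<Lambda> p q 0 1"
  shows "hopf_lattice elt c0 (- b0) L (ring_of_integers L) (nonclassical_hopf L \<sigma> d) \<Lambda>"
proof
  show "h \<in> nonclassical_hopf L \<sigma> d \<longleftrightarrow> h \<in> extensional L \<and> (\<exists>\<alpha> \<beta> \<gamma> \<delta>. \<forall>p q x y. h (elt p q x y) =
      elt (\<alpha> * p) (\<beta> * q) (\<gamma> * x + \<delta> * (of_int c0 * x + of_int (- b0) * y))
        (\<gamma> * y + \<delta> * (of_int (- b0) * x - of_int c0 * y)))" for h
    unfolding nonclassical_hopf_iff by (simp add: algebra_simps)
  show "coprime c0 (- b0)" using coprime_b0_c0 by (simp add: coprime_commute)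
qed (use assms elt_inject adjoin_eq in auto)

text \<open>Coordinates with respect to \<open>1\<close>, \<open>\<surd>d\<close>, \<open>\<rho> (z + \<epsilon> w)\<close>, \<open>\<rho> (z - \<epsilon> w)\<close>.\<close>

definition rot :: "rat \<Rightarrow> int \<Rightarrow> rat \<Rightarrow> rat \<Rightarrow> rat \<Rightarrow> rat \<Rightarrow> complex" where
  "rot \<rho> \<epsilon> p q x y = elt p q (\<rho> * (x + y)) (\<rho> * of_int \<epsilon> * (x - y))"

lemma rot_surj:
  fixes \<epsilon> :: int
  assumes "\<rho> \<noteq> 0" "\<epsilon> = 1 \<or> \<epsilon> = -1"
  obtains x y where "elt p q r t = rot \<rho> \<epsilon> p q x y"
proof
  show "elt p q r t = rot \<rho> \<epsilon> p q ((r + of_int \<epsilon> * t) / (2 * \<rho>)) ((r - of_int \<epsilon> * t) / (2 * \<rho>))"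
    using assms by (auto simp: rot_def elt_inject field_simps)
qed

text \<open>Passing from z, w to z + \<epsilon> w, z - \<epsilon> w exchanges b0 and c0 in the
  matrix of \<open>M\<close> up to sign. This puts the odd one off the diagonal when b0 is
  even.\<close>

lemma hopf_lattice_rot:
  fixes \<epsilon> :: int
  assumes "odd c0" "\<rho> \<noteq> 0" and \<epsilon>: "\<epsilon> = 1 \<or> \<epsilon> = -1"
    and "ring_of_integers L = {rot \<rho> \<epsilon> p q x y | p q x y. \<Lambda> p q x y}"
    and "\<And>p q x y. \<Lambda> p q x y \<Longrightarrow> x \<in> \<int> \<and> y \<in> \<int>" "\<exists>p q. \<Lambda> p q 1 0" "\<exists>p q. \<Lambda> p q 0 1"
  shows "hopf_lattice (rot \<rho> \<epsilon>) (- \<epsilon> * b0) c0 L (ring_of_integers L) (nonclassical_hopf L \<sigma> d) \<Lambda>"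
proof
  show "rot \<rho> \<epsilon> p q x y = rot \<rho> \<epsilon> p' q' x' y' \<longleftrightarrow> p = p' \<and> q = q' \<and> x = x' \<and> y = y'" for p q x y p' q' x' y'
    using assms(2,3) by (auto simp: rot_def elt_inject)
  show "L = {rot \<rho> \<epsilon> p q x y | p q x y. True}"
    unfolding adjoin_eq using rot_surj[OF assms(2,3)] by (auto simp: rot_def) metis
  have act: "elt (\<alpha> * p) (\<beta> * q)
      (\<gamma> * (\<rho> * (x + y)) + \<delta> * (of_int c0 * (\<rho> * (x + y)) - of_int b0 * (\<rho> * of_int \<epsilon> * (x - y))))
      (\<gamma> * (\<rho> * of_int \<epsilon> * (x - y)) - \<delta> * (of_int b0 * (\<rho> * (x + y)) + of_int c0 * (\<rho> * of_int \<epsilon> * (x - y))))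
    = rot \<rho> \<epsilon> (\<alpha> * p) (\<beta> * q) (\<gamma> * x + \<delta> * (of_int (- \<epsilon> * b0) * x + of_int c0 * y))
        (\<gamma> * y + \<delta> * (of_int c0 * x - of_int (- \<epsilon> * b0) * y))" for \<alpha> \<beta> \<gamma> \<delta> p q x y
    using \<epsilon> by (auto simp: rot_def elt_inject algebra_simps)
  have "(\<forall>p q r t. h (elt p q r t) = elt (\<alpha> * p) (\<beta> * q)
      (\<gamma> * r + \<delta> * (of_int c0 * r - of_int b0 * t)) (\<gamma> * t - \<delta> * (of_int b0 * r + of_int c0 * t)))
    \<longleftrightarrow> (\<forall>p q x y. h (rot \<rho> \<epsilon> p q x y) = rot \<rho> \<epsilon> (\<alpha> * p) (\<beta> * q)
        (\<gamma> * x + \<delta> * (of_int (- \<epsilon> * b0) * x + of_int c0 * y))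
        (\<gamma> * y + \<delta> * (of_int c0 * x - of_int (- \<epsilon> * b0) * y)))" (is "?l \<longleftrightarrow> ?r") for h \<alpha> \<beta> \<gamma> \<delta>
  proof
    assume ?l
    then show ?r by (simp only: act[symmetric]) (simp add: rot_def)
  next
    assume r: ?r
    show ?l
    proof (intro allI)
      fix p q r t
      obtain x y where "elt p q r t = rot \<rho> \<epsilon> p q x y" using rot_surj[OF assms(2,3)] .
      then have rt: "r = \<rho> * (x + y)" "t = \<rho> * of_int \<epsilon> * (x - y)"
        by (simp_all add: rot_def elt_inject)
      show "h (elt p q r t) = elt (\<alpha> * p) (\<beta> * q)
        (\<gamma> * r + \<delta> * (of_int c0 * r - of_int b0 * t)) (\<gamma> * t - \<delta> * (of_int b0 * r + of_int c0 * t))"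
        unfolding rt act using r by (simp only: rot_def)
    qed
  qed
  then show "h \<in> nonclassical_hopf L \<sigma> d \<longleftrightarrow> h \<in> extensional L \<and> (\<exists>\<alpha> \<beta> \<gamma> \<delta>. \<forall>p q x y. h (rot \<rho> \<epsilon> p q x y) =
      rot \<rho> \<epsilon> (\<alpha> * p) (\<beta> * q) (\<gamma> * x + \<delta> * (of_int (- \<epsilon> * b0) * x + of_int c0 * y))
        (\<gamma> * y + \<delta> * (of_int c0 * x - of_int (- \<epsilon> * b0) * y)))" for h
    unfolding nonclassical_hopf_iff by (simp only:)
  show "coprime (- \<epsilon> * b0) c0" using \<epsilon> coprime_b0_c0 by auto
qed (use assms in auto)

end

lemma combination_4:
  "combination [q0, q1, q2, q3] [v0, v1, v2, v3]
    = of_rat q0 * v0 + of_rat q1 * v1 + of_rat q2 * v2 + of_rat q3 * v3"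
  by (simp add: combination_def numeral_eq_Suc)

lemma lat_diag_proj:
  "lat_diag p q x y \<Longrightarrow> x \<in> \<int> \<and> y \<in> \<int>" "\<exists>p q. lat_diag p q 1 0" "\<exists>p q. lat_diag p q 0 1"
proof -
  have "lat_diag 0 0 (of_int x) (of_int y)" for x y
    unfolding lat_diag_def by (rule exI[of _ 0], rule exI[of _ 0], rule exI[of _ x], rule exI[of _ y]) simp
  from this[of 1 0] this[of 0 1]
  show "\<exists>p q. lat_diag p q 1 0" "\<exists>p q. lat_diag p q 0 1" by auto
qed (auto simp: lat_diag_def)

lemma lat_half_proj:
  "lat_half p q x y \<Longrightarrow> x \<in> \<int> \<and> y \<in> \<int>" "\<exists>p q. lat_half p q 1 0" "\<exists>p q. lat_half p q 0 1"
proof -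
  have "lat_half 0 0 (of_int x) (of_int y)" for x y
    unfolding lat_half_def by (rule exI[of _ 0], rule exI[of _ 0], rule exI[of _ x], rule exI[of _ y]) simp
  from this[of 1 0] this[of 0 1]
  show "\<exists>p q. lat_half p q 1 0" "\<exists>p q. lat_half p q 0 1" by auto
qed (auto simp: lat_half_def)

lemma lat_quarter_proj:
  "lat_quarter p q x y \<Longrightarrow> x \<in> \<int> \<and> y \<in> \<int>" "\<exists>p q. lat_quarter p q 1 0" "\<exists>p q. lat_quarter p q 0 1"
proof -
  have "lat_quarter ((of_int x + of_int y) / 4) ((of_int x - of_int y) / 4) (of_int x) (of_int y)" for x y
    unfolding lat_quarter_def by (rule exI[of _ 0], rule exI[of _ 0], rule exI[of _ x], rule exI[of _ y]) simp
  from this[of 1 0] this[of 0 1]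
  show "\<exists>p q. lat_quarter p q 1 0" "\<exists>p q. lat_quarter p q 0 1" by auto
qed (auto simp: lat_quarter_def)

lemma ceiling_half:
  fixes v :: int
  shows "2 * \<lceil>of_int v / 2 :: rat\<rceil> = v + (if even v then 0 else 1)"
proof (cases "even v")
  case True
  then obtain k where "v = 2 * k" by (rule evenE)
  then show ?thesis by simp
next
  case False
  then obtain k where k: "v = 2 * k + 1" by (rule oddE)
  have "\<lceil>of_int v / 2 :: rat\<rceil> = k + 1"
    by (rule ceiling_unique) (simp_all add: k field_simps)
  with False k show ?thesis by simp
qed

lemma odd_cong_4:
  fixes x y :: int
  assumes "odd x" "odd y" "\<not> [x = y] (mod 4)" shows "[x = - y] (mod 4)"
  using assms unfolding cong_iff_dvd_diff by presburger

context cyclic_quartic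
begin

abbreviation "order_L \<equiv> associated_order (nonclassical_hopf L \<sigma> d) (ring_of_integers L)"

lemma hopf_lattice_even_d:
  assumes "odd b0" "odd c0"
  shows "hopf_lattice elt c0 (- b0) L (ring_of_integers L) (nonclassical_hopf L \<sigma> d) lat_diag"
proof (rule hopf_lattice_std[OF assms(1) _ lat_diag_proj])
  show "ring_of_integers L = {elt p q x y | p q x y. lat_diag p q x y}"
    unfolding set_eq_iff integers_even_d[OF assms] lat_diag_def by blast
qed

lemma hopf_lattice_odd_b0:
  assumes "odd b0" "even c0"
  shows "hopf_lattice elt c0 (- b0) L (ring_of_integers L) (nonclassical_hopf L \<sigma> d) lat_half"
proof (rule hopf_lattice_std[OF assms(1) _ lat_half_proj])
  show "ring_of_integers L = {elt p q x y | p q x y. lat_half p q x y}"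
    unfolding set_eq_iff integers_odd_b0[OF assms] lat_half_def by blast
qed

lemma hopf_lattice_half:
  assumes "even b0" "odd c0" "\<not> [a + b0 = 1] (mod 4)"
  shows "hopf_lattice (rot (1/2) 1) (- b0) c0 L (ring_of_integers L) (nonclassical_hopf L \<sigma> d) lat_half"
proof -
  have rot: "rot (1/2) 1 p q x y = elt p q ((x + y) / 2) ((x - y) / 2)" for p q x y
    by (simp add: rot_def)
  have "ring_of_integers L = {rot (1/2) 1 p q x y | p q x y. lat_half p q x y}"
    unfolding set_eq_iff integers_half[OF assms] lat_half_def rot by blast
  from hopf_lattice_rot[OF assms(2) _ _ this lat_half_proj] show ?thesis by simp
qed

lemma hopf_lattice_quarter:
  fixes \<epsilon> :: int
  assumes "even b0" "odd c0" "[a + b0 = 1] (mod 4)" "\<epsilon> = 1 \<or> \<epsilon> = -1" "[a = \<epsilon> * c0] (mod 4)"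
  shows "hopf_lattice (rot (1/4) \<epsilon>) (- \<epsilon> * b0) c0 L (ring_of_integers L) (nonclassical_hopf L \<sigma> d) lat_quarter"
proof -
  have "ring_of_integers L = {rot (1/4) \<epsilon> p q x y | p q x y. lat_quarter p q x y}"
    unfolding set_eq_iff integers_quarter[OF assms] lat_quarter_def rot_def by (simp, blast)
  from hopf_lattice_rot[OF assms(2) _ assms(4) this lat_quarter_proj] show ?thesis by simp
qed

section \<open>Explicit generators\<close>

lemma generator_even_d:
  assumes "odd b0" "odd c0" "b0 * U^2 + 2 * c0 * U * V - b0 * V^2 = 1"
  shows "is_free_generator order_L (ring_of_integers L) (combination [1, 1, of_int U, of_int V] [1, s, z, w])"
proof -
  interpret hopf_lattice elt c0 "- b0" L "ring_of_integers L" "nonclassical_hopf L \<sigma> d" lat_diag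
    by (rule hopf_lattice_even_d[OF assms(1,2)])
  have "lat_diag 1 1 (of_int U) (of_int V)"
    unfolding lat_diag_def by (rule exI[of _ 1], rule exI[of _ 1], rule exI[of _ U], rule exI[of _ V]) simp
  \<comment> \<open>Here n = - b0, so the form of the locale takes the value -1.\<close>
  then have "is_free_generator order_L (ring_of_integers L) (elt 1 1 (of_int U) (of_int V))"
    by (rule form_imp_generator[where \<kappa> = "-1"], simp, simp, use assms(3) in linarith, simp)
       (rule lat_diag_scale)
  then show ?thesis by (simp add: combination_4 elt_def)
qed

lemma generator_odd_b0:
  assumes "odd b0" "even c0" "b0 * U^2 + 2 * c0 * U * V - b0 * V^2 = 1"
  shows "is_free_generator order_L (ring_of_integers L)
    (combination [0, 1, of_int U, of_int V] [1, (1 + s) / 2, z, w])"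
proof -
  interpret hopf_lattice elt c0 "- b0" L "ring_of_integers L" "nonclassical_hopf L \<sigma> d" lat_half
    by (rule hopf_lattice_odd_b0[OF assms(1,2)])
  have "lat_half (1/2) (1/2) (of_int U) (of_int V)"
    unfolding lat_half_def by (rule exI[of _ 0], rule exI[of _ 1], rule exI[of _ U], rule exI[of _ V]) simp
  then have "is_free_generator order_L (ring_of_integers L) (elt (1/2) (1/2) (of_int U) (of_int V))"
    by (rule form_imp_generator[where \<kappa> = "-1"], simp, simp, use assms(3) in linarith, simp)
       (rule lat_half_scale)
  then show ?thesis by (simp add: combination_4 elt_def of_rat_divide field_simps)
qed

lemma generator_half:
  assumes "even b0" "odd c0" "\<not> [a + b0 = 1] (mod 4)" "c0 * U^2 + 2 * b0 * U * V - c0 * V^2 = 1"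
  shows "is_free_generator order_L (ring_of_integers L)
    (combination [0, 1, of_int U, of_int V] [1, (1 + s) / 2, (z + w) / 2, (z - w) / 2])"
proof -
  interpret hopf_lattice "rot (1/2) 1" "- b0" c0 L "ring_of_integers L" "nonclassical_hopf L \<sigma> d" lat_half
    by (rule hopf_lattice_half[OF assms(1-3)])
  have "lat_half (1/2) (1/2) (of_int U) (of_int V)"
    unfolding lat_half_def by (rule exI[of _ 0], rule exI[of _ 1], rule exI[of _ U], rule exI[of _ V]) simp
  then have "is_free_generator order_L (ring_of_integers L) (rot (1/2) 1 (1/2) (1/2) (of_int U) (of_int V))"
    by (rule form_imp_generator[where \<kappa> = 1], simp, simp, use assms(4) in linarith, simp)
       (rule lat_half_scale)
  moreover have "rot (1/2) 1 (1/2) (1/2) (of_int U) (of_int V)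
      = combination [0, 1, of_int U, of_int V] [1, (1 + s) / 2, (z + w) / 2, (z - w) / 2]"
    by (simp add: combination_4 rot_def elt_def of_rat_divide of_rat_mult of_rat_add of_rat_diff field_simps)
  ultimately show ?thesis by simp
qed

text \<open>The second coordinate is chosen to make 4 q0 = 1. Then 4 p0 is 1 + 2 v plus four times
  the first coordinate, and the ceiling brings it down to \<eta> = 1 for even v and \<eta> = -1 for
  odd v. Both signs of \<kappa> are allowed because Case 5 leads to -1.\<close>

lemma generator_quarter:
  fixes \<epsilon> \<kappa> :: int
  assumes "even b0" "odd c0" "[a + b0 = 1] (mod 4)" "\<epsilon> = 1 \<or> \<epsilon> = -1" "[a = \<epsilon> * c0] (mod 4)"
    and form: "c0 * u^2 + 2 * \<epsilon> * b0 * u * v - c0 * v^2 = \<kappa>" and \<kappa>: "\<kappa> = 1 \<or> \<kappa> = -1"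
  shows "(of_int v - of_int u + 1) / 2 \<in> (\<int> :: rat set)"
    and "is_free_generator order_L (ring_of_integers L)
      (combination [- of_int \<lceil>of_int v / 2 :: rat\<rceil>, (of_int v - of_int u + 1) / 2, of_int u, of_int v]
        [1, (1 + s) / 2, (1 + s + z + of_int \<epsilon> * w) / 4, (1 - s + z - of_int \<epsilon> * w) / 4])"
proof -
  interpret hopf_lattice "rot (1/4) \<epsilon>" "- \<epsilon> * b0" c0 L "ring_of_integers L" "nonclassical_hopf L \<sigma> d" lat_quarter
    by (rule hopf_lattice_quarter[OF assms(1-5)])
  have "odd (c0 * u^2 + 2 * \<epsilon> * b0 * u * v - c0 * v^2)" unfolding form using \<kappa> by auto
  then have "even (v - u + 1)" using assms(2) by auto
  then obtain K where K: "v - u + 1 = 2 * K" by (rule evenE)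
  then have u: "u = v + 1 - 2 * K" by simp
  define cl where "cl = \<lceil>of_int v / 2 :: rat\<rceil>"
  define \<eta> where "\<eta> = 1 + 2 * v - 4 * cl"
  have \<eta>: "\<eta> = 1 \<or> \<eta> = -1" using ceiling_half[of v] by (auto simp: \<eta>_def cl_def split: if_splits)
  have K_rat: "(of_int v - of_int u + 1) / 2 = (of_int K :: rat)" by (simp add: u)
  then show "(of_int v - of_int u + 1) / 2 \<in> (\<int> :: rat set)" by simp
  have "lat_quarter (of_int \<eta> / 4) (1/4) (of_int u) (of_int v)"
    unfolding lat_quarter_iff
    by (rule exI[of _ "- cl"], rule exI[of _ K]) (simp add: u \<eta>_def)
  note lat = this
  have "is_free_generator order_L (ring_of_integers L) (rot (1/4) \<epsilon> (of_int \<eta> / 4) (1/4) (of_int u) (of_int v))"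
  proof (rule form_imp_generator[OF lat])
    show "c0 * u^2 - 2 * (- \<epsilon> * b0) * u * v - c0 * v^2 = \<kappa>" using form by simp
    have "even (- \<epsilon> * b0)" using assms(1) by simp
    from lat_quarter_scale[OF this assms(2) \<eta> lat]
    show "lat_quarter p q (of_int (g * u + k * (- \<epsilon> * b0 * u + c0 * v)))
        (of_int (g * v + k * (c0 * u - - \<epsilon> * b0 * v))) \<Longrightarrow>
      lat_quarter p' q' (of_int i) (of_int j) \<Longrightarrow>
      lat_quarter (p / (of_int \<eta> / 4) * p') (q / (1/4) * q') (of_int (g * i + k * (- \<epsilon> * b0 * i + c0 * j)))
        (of_int (g * j + k * (c0 * i - - \<epsilon> * b0 * j)))" for p q g k p' q' i j .
  qed (use \<eta> \<kappa> in auto)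
  moreover have "rot (1/4) \<epsilon> (of_int \<eta> / 4) (1/4) (of_int u) (of_int v)
      = combination [- of_int cl, of_int K, of_int u, of_int v]
        [1, (1 + s) / 2, (1 + s + z + of_int \<epsilon> * w) / 4, (1 - s + z - of_int \<epsilon> * w) / 4]"
    by (simp add: combination_4 rot_def elt_def of_rat_divide of_rat_mult of_rat_add of_rat_diff
        of_rat_minus u \<eta>_def field_simps)
  ultimately show "is_free_generator order_L (ring_of_integers L)
      (combination [- of_int \<lceil>of_int v / 2 :: rat\<rceil>, (of_int v - of_int u + 1) / 2, of_int u, of_int v]
        [1, (1 + s) / 2, (1 + s + z + of_int \<epsilon> * w) / 4, (1 - s + z - of_int \<epsilon> * w) / 4])"
    unfolding K_rat cl_def by simp
qed

end

theorem theorem4p3: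
  fixes a b0 c0 d b c :: int
    and L OL :: "complex set"
    and \<sigma> :: "complex \<Rightarrow> complex"
    and H AH :: "(complex \<Rightarrow> complex) set"
  assumes "odd a" and "squarefree a"
    and "b0 > 0" and "c0 > 0"
    and "d = b0^2 + c0^2" and "squarefree d" and "coprime a d"
    and "L = adjoin (gen_z a b0 d)"
    and "OL = ring_of_integers L"
    and "\<sigma> \<in> galois_group L"
    and "\<sigma> (gen_z a b0 d) = gen_w a b0 d" and "\<sigma> (gen_w a b0 d) = - gen_z a b0 d"
    and "H = nonclassical_hopf L \<sigma> d"
    and "AH = associated_order H OL"
    and "(b, c) = (if odd b0 then (b0, c0) else (c0, b0))"
  shows "(free_of_rank_one AH OL \<longleftrightarrow> form_represents b (2 * c) (- b) 1)
    \<and> (form_represents b (2 * c) (- b) 1 \<longleftrightarrow>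
         (\<exists>x y :: int. x^2 - d * y^2 = b \<and> b dvd x - c * y))
    \<and> (\<forall>x y :: int. x^2 - d * y^2 = b \<and> b dvd x - c * y \<longrightarrow>
         set (generator_coords a b0 c0 d b c x y) \<subseteq> \<int>
         \<and> is_free_generator AH OL
             (combination (generator_coords a b0 c0 d b c x y) (integral_basis a b0 c0 d)))"
proof -
  interpret cyclic_quartic a b0 c0 d \<sigma>
    using assms by unfold_locales simp_all
  have O: "OL = ring_of_integers (adjoin z)" and A: "AH = order_L"
    using assms by simp_all
  have parity: "odd b0 \<or> odd c0"
  proof (rule ccontr)
    assume "\<not> (odd b0 \<or> odd c0)"
    then have "2^2 dvd b0^2" "2^2 dvd c0^2" by (simp_all only: dvd_power_same not_not de_Morgan_disj)
    then have "2^2 dvd d" unfolding d_eq by (rule dvd_add)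
    then have "(2 :: int) dvd 1" by (rule squarefreeD[OF sqf_d])
    then show False by simp
  qed
  have bc: "b = (if odd b0 then b0 else c0)" "c = (if odd b0 then c0 else b0)"
    using assms(15) by (simp_all split: if_splits)
  have b: "b \<noteq> 0" "b > 0" using b0_pos c0_pos by (simp_all add: bc)
  have d: "d = b^2 + c^2" by (simp add: bc d_eq)
  \<comment> \<open>Both implications go through the same five cases and are proved together; V is
    the y of a solution and U is its x'.\<close>
  have claim: "(is_free_generator AH OL \<beta> \<longrightarrow> form_represents b (2 * c) (- b) 1)
    \<and> (b * U^2 + 2 * c * U * V - b * V^2 = 1 \<and> x - c * V = b * U \<longrightarrow>
         set (generator_coords a b0 c0 d b c x V) \<subseteq> \<int>
         \<and> is_free_generator AH OL
             (combination (generator_coords a b0 c0 d b c x V) (integral_basis a b0 c0 d)))" for \<beta> x U V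
  proof -
    have x': "of_int (x - c * V) / of_int b = (of_int U :: rat)" if "x - c * V = b * U"
      using that b by simp
    consider (1) "odd b0" "odd c0" | (2) "odd b0" "even c0"
      | (3) "even b0" "odd c0" "\<not> [a + b0 = 1] (mod 4)"
      | (4) "even b0" "odd c0" "[a + b0 = 1] (mod 4)" "[a = c0] (mod 4)"
      | (5) "even b0" "odd c0" "[a + b0 = 1] (mod 4)" "\<not> [a = c0] (mod 4)" "[a = - c0] (mod 4)"
      using parity odd_cong_4[OF odd_a, of c0] by blast
    then show ?thesis
    proof cases
      case 1
      interpret hopf_lattice elt c0 "- b0" "adjoin z" "ring_of_integers (adjoin z)"
        "nonclassical_hopf (adjoin z) \<sigma> d" lat_diag
        by (rule hopf_lattice_even_d[OF 1])
      have "case1 d" using 1 by (simp add: case1_def d_eq)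
      then show ?thesis
        using 1 x' generator_even_d[OF 1] generator_imp_form[of \<beta>] form_represents_1I[of "- b0" _ c0 _ b0 c0]
        unfolding O A by (auto simp: bc generator_coords_def integral_basis_def Let_def)
    next
      case 2
      interpret hopf_lattice elt c0 "- b0" "adjoin z" "ring_of_integers (adjoin z)"
        "nonclassical_hopf (adjoin z) \<sigma> d" lat_half
        by (rule hopf_lattice_odd_b0[OF 2])
      have "\<not> case1 d" "case2 b0 d" using 2 by (simp_all add: case1_def case2_def d_eq)
      then show ?thesis
        using 2 x' generator_odd_b0[OF 2] generator_imp_form[of \<beta>] form_represents_1I[of "- b0" _ c0 _ b0 c0]
        unfolding O A by (auto simp: bc generator_coords_def integral_basis_def Let_def)
    next
      case 3
      interpret hopf_lattice "rot (1/2) 1" "- b0" c0 "adjoin z" "ring_of_integers (adjoin z)"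
        "nonclassical_hopf (adjoin z) \<sigma> d" lat_half
        by (rule hopf_lattice_half[OF 3])
      have "[a + b0 = 3] (mod 4)"
        using 3 odd_cong_4[of "a + b0" 1] odd_a by (simp add: cong_def)
      then have "\<not> case1 d" "\<not> case2 b0 d" "case3 a b0 d"
        using 3 by (simp_all add: case1_def case2_def case3_def d_eq)
      then show ?thesis
        using 3 x' generator_half[OF 3] generator_imp_form[of \<beta>] form_represents_1I[of c0 _ "- b0" _ c0 b0]
        unfolding O A by (auto simp: bc generator_coords_def integral_basis_def Let_def)
    next
      case 4
      interpret hopf_lattice "rot (1/4) 1" "- 1 * b0" c0 "adjoin z" "ring_of_integers (adjoin z)"
        "nonclassical_hopf (adjoin z) \<sigma> d" lat_quarter
        by (rule hopf_lattice_quarter) (use 4 in simp_all)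
      have "\<not> [a + b0 = 3] (mod 4)" using 4 by (simp add: cong_def)
      then have "\<not> case1 d" "\<not> case2 b0 d" "\<not> case3 a b0 d" "case4 a b0 c0 d"
        using 4 by (simp_all add: case1_def case2_def case3_def case4_def d_eq)
      then show ?thesis
        using 4 x' generator_quarter[of 1 U V 1] generator_imp_form[of \<beta>] form_represents_1I[of c0 _ "- 1 * b0" _ c0 b0]
        unfolding O A by (auto simp: bc generator_coords_def integral_basis_def Let_def)
    next
      case 5
      interpret hopf_lattice "rot (1/4) (- 1)" "- (- 1) * b0" c0 "adjoin z" "ring_of_integers (adjoin z)"
        "nonclassical_hopf (adjoin z) \<sigma> d" lat_quarter
        by (rule hopf_lattice_quarter) (use 5 in simp_all)
      have "\<not> [a + b0 = 3] (mod 4)" using 5 by (simp add: cong_def)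
      then have cases: "\<not> case1 d" "\<not> case2 b0 d" "\<not> case3 a b0 d" "\<not> case4 a b0 c0 d" "case5 a b0 c0 d"
        using 5 by (simp_all add: case1_def case2_def case3_def case4_def case5_def d_eq)
      have y': "1 - (of_int V - of_int U + 1) / 2 = (of_int U - of_int V + 1) / (2 :: rat)"
        by (simp add: field_simps)
      \<comment> \<open>Case 5 is the quarter generator for \<epsilon> = -1 with U and V exchanged,
        and this negates the value of the form.\<close>
      have form: "c0 * V^2 + 2 * (- 1) * b0 * V * U - c0 * U^2 = - 1"
        if "c0 * U^2 + 2 * b0 * U * V - c0 * V^2 = 1"
        using that by (simp add: algebra_simps)
      show ?thesis
        using 5 cases form x' generator_quarter[of "- 1" V U "- 1"] generator_imp_form[of \<beta>] form_represents_1I[of c0 _ "- (- 1) * b0" _ c0 b0]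
        unfolding O A by (auto simp: y' bc generator_coords_def integral_basis_def Let_def)
    qed
  qed
  have sol: "set (generator_coords a b0 c0 d b c x y) \<subseteq> \<int>
      \<and> is_free_generator AH OL (combination (generator_coords a b0 c0 d b c x y) (integral_basis a b0 c0 d))"
    if "x^2 - d * y^2 = b" "b dvd x - c * y" for x y
  proof -
    from that(2) obtain U where U: "x - c * y = b * U" by (rule dvdE)
    then show ?thesis using claim equation_imp_form[OF b(1) d that(1) U] by blast
  qed
  have iff: "form_represents b (2 * c) (- b) 1 \<longleftrightarrow> (\<exists>x y. x^2 - d * y^2 = b \<and> b dvd x - c * y)"
    by (rule form_represents_iff_equation[OF b(1) d])
  have "free_of_rank_one AH OL \<longleftrightarrow> form_represents b (2 * c) (- b) 1"
    using claim sol iff unfolding free_of_rank_one_def by blast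
  with iff sol show ?thesis by blast
qed

end
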